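(* Let $p$ be an odd prime, let $m,n$ be integers with $m\ge n+2\ge 3$, and let $\lambda\in\mathbb{Z}_{p^m}^*$ have multiplicative order $p^{n+1}$. Then $\mathrm{MP}_{p^m,p^n,p^{m-1},\lambda}$ is a weak metacirculant which is a Cayley graph but not a weak metacirculant Cayley graph.
   Context: All graphs are finite, simple and undirected. A group is metacyclic if it has a cyclic normal subgroup with cyclic quotient. A weak metacirculant is a graph whose automorphism group contains a metacyclic subgroup acting transitively on the vertex set. The Cayley graph $\mathrm{Cay}(G,S)$ ($S\subseteq G\setminus\{1\}$ inverse-closed) has vertex set $G$ and edges $\{g,sg\}$; a graph is a Cayley graph if isomorphic to one, and a weak metacirculant Cayley graph if isomorphic to a Cayley graph of a metacyclic group. Multilayer generalized Petersen graph $\mathrm{MP}_{M,N,s,t}$ (for $M\ge3$, $N\ge 2$, $s\mid M$, $t$ coprime to $M$): with $H=\langle h\rangle\cong C_M$, for $i\in\mathbb{Z}_N$ let $V_i=\{(h^j,i): j\in\mathbb{Z}_M\}$, $E_i=\{\{(h^j,i),(h^{j+ks+t^i},i)\},\{(h^j,i),(h^{j-ks-t^i},i)\}: k\in\mathbb{Z}_{M/s}, j\in\mathbb{Z}_M\}$, $E_{i,i+1}=\{\{(h^j,i),(h^j,i+1)\}: j\in\mathbb{Z}_M\}$ (layer indices mod $N$); the graph has vertex set $\bigcup_i V_i$ and edge set $\bigcup_i(E_i\cup E_{i,i+1})$. Exponents of $h$ are read mod $M$. *)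

theory Defs
  imports "HOL-Algebra.Algebra" "HOL-Number_Theory.Number_Theory"
begin

record 'v ugraph =
  verts :: "'v set"
  edges :: "'v set set"

definition simple_graph :: "'v ugraph \<Rightarrow> bool" where
  "simple_graph \<Gamma> \<longleftrightarrow> finite (verts \<Gamma>) \<and>
     edges \<Gamma> \<subseteq> {{u, v} | u v. u \<in> verts \<Gamma> \<and> v \<in> verts \<Gamma> \<and> u \<noteq> v}"

definition graph_isomorphism :: "'v ugraph \<Rightarrow> 'w ugraph \<Rightarrow> ('v \<Rightarrow> 'w) \<Rightarrow> bool" where
  "graph_isomorphism \<Gamma> \<Delta> f \<longleftrightarrow> bij_betw f (verts \<Gamma>) (verts \<Delta>) \<and>
     (\<forall>u\<in>verts \<Gamma>. \<forall>v\<in>verts \<Gamma>. {u, v} \<in> edges \<Gamma> \<longleftrightarrow> {f u, f v} \<in> edges \<Delta>)"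

definition isomorphic_graphs :: "'v ugraph \<Rightarrow> 'w ugraph \<Rightarrow> bool" where
  "isomorphic_graphs \<Gamma> \<Delta> \<longleftrightarrow> (\<exists>f. graph_isomorphism \<Gamma> \<Delta> f)"

definition aut_group :: "'v ugraph \<Rightarrow> ('v \<Rightarrow> 'v) monoid" where
  "aut_group \<Gamma> =
     (BijGroup (verts \<Gamma>))\<lparr>carrier := {f \<in> Bij (verts \<Gamma>). graph_isomorphism \<Gamma> \<Gamma> f}\<rparr>"

definition metacyclic_group :: "('g, 'x) monoid_scheme \<Rightarrow> bool" where
  "metacyclic_group G \<longleftrightarrow> group G \<and>
     (\<exists>N. N \<lhd> G \<and> cyclic_group (G\<lparr>carrier := N\<rparr>) \<and> cyclic_group (G Mod N))"

definition weak_metacirculant :: "'v ugraph \<Rightarrow> bool" where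
  "weak_metacirculant \<Gamma> \<longleftrightarrow> simple_graph \<Gamma> \<and>
     (\<exists>R. subgroup R (aut_group \<Gamma>) \<and>
          metacyclic_group ((aut_group \<Gamma>)\<lparr>carrier := R\<rparr>) \<and>
          transitive_action ((aut_group \<Gamma>)\<lparr>carrier := R\<rparr>) (verts \<Gamma>) (\<lambda>g. g))"

definition connection_set :: "('g, 'x) monoid_scheme \<Rightarrow> 'g set \<Rightarrow> bool" where
  "connection_set G S \<longleftrightarrow> S \<subseteq> carrier G - {\<one>\<^bsub>G\<^esub>} \<and> (\<forall>s\<in>S. inv\<^bsub>G\<^esub> s \<in> S)"

definition Cay :: "('g, 'x) monoid_scheme \<Rightarrow> 'g set \<Rightarrow> 'g ugraph" where
  "Cay G S = \<lparr>verts = carrier G,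
              edges = {{g, s \<otimes>\<^bsub>G\<^esub> g} | g s. g \<in> carrier G \<and> s \<in> S}\<rparr>"

text \<open>
  HOL cannot quantify over the type carrying the group, so the next two definitions let it
  range over groups whose elements are natural numbers.  Graphs being finite, this loses no
  generality: see \<open>Cayley_graphI\<close> and \<open>weak_metacirculant_Cayley_graphI\<close> below.
\<close>

definition Cayley_graph :: "'v ugraph \<Rightarrow> bool" where
  "Cayley_graph \<Gamma> \<longleftrightarrow> simple_graph \<Gamma> \<and>
     (\<exists>(G :: nat monoid) S. group G \<and> connection_set G S \<and> isomorphic_graphs \<Gamma> (Cay G S))"

definition weak_metacirculant_Cayley_graph :: "'v ugraph \<Rightarrow> bool" where
  "weak_metacirculant_Cayley_graph \<Gamma> \<longleftrightarrow> simple_graph \<Gamma> \<and>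
     (\<exists>(G :: nat monoid) S. metacyclic_group G \<and> connection_set G S \<and>
        isomorphic_graphs \<Gamma> (Cay G S))"

text \<open>
  The pair \<open>(j, i)\<close> with \<open>0 \<le> j < M\<close> and \<open>i < N\<close> stands for the vertex \<open>(h\<^sup>j, i)\<close>.  The power
  \<open>t\<^sup>i\<close> is taken with \<open>i\<close> the representative in \<open>{0..<N}\<close> of the layer; it need not depend
  only on \<open>i\<close> modulo \<open>N\<close>.
\<close>

definition MP_verts :: "nat \<Rightarrow> nat \<Rightarrow> (int \<times> nat) set" where
  "MP_verts M N = {0..<int M} \<times> {0..<N}"

definition MP_layer_edges :: "nat \<Rightarrow> nat \<Rightarrow> nat \<Rightarrow> nat \<Rightarrow> (int \<times> nat) set set" where
  "MP_layer_edges M s t i =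
     (\<Union>k\<in>{0..<M div s}. \<Union>j\<in>{0..<int M}.
        {{(j, i), ((j + int k * int s + int t ^ i) mod int M, i)},
         {(j, i), ((j - int k * int s - int t ^ i) mod int M, i)}})"

definition MP_cross_edges :: "nat \<Rightarrow> nat \<Rightarrow> nat \<Rightarrow> (int \<times> nat) set set" where
  "MP_cross_edges M N i = {{(j, i), (j, (i + 1) mod N)} | j. j \<in> {0..<int M}}"

definition MP :: "nat \<Rightarrow> nat \<Rightarrow> nat \<Rightarrow> nat \<Rightarrow> (int \<times> nat) ugraph" where
  "MP M N s t =
     \<lparr>verts = MP_verts M N,
      edges = (\<Union>i\<in>{0..<N}. MP_layer_edges M s t i \<union> MP_cross_edges M N i)\<rparr>"


text \<open>Independence of the type carrying the group.\<close>

lemma isomorphic_graphs_trans: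
  assumes "isomorphic_graphs \<Gamma> \<Delta>" "isomorphic_graphs \<Delta> \<Theta>"
  shows "isomorphic_graphs \<Gamma> \<Theta>"
proof -
  obtain f g where f: "graph_isomorphism \<Gamma> \<Delta> f" and g: "graph_isomorphism \<Delta> \<Theta> g"
    using assms unfolding isomorphic_graphs_def by blast
  have "bij_betw (g \<circ> f) (verts \<Gamma>) (verts \<Theta>)"
    using f g bij_betw_trans unfolding graph_isomorphism_def by blast
  moreover have "f u \<in> verts \<Delta>" if "u \<in> verts \<Gamma>" for u
    using f that unfolding graph_isomorphism_def by (meson bij_betwE)
  ultimately have "graph_isomorphism \<Gamma> \<Theta> (g \<circ> f)"
    using f g unfolding graph_isomorphism_def by simp
  then show ?thesis
    unfolding isomorphic_graphs_def by blast
qed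

lemma metacyclic_group_iso:
  assumes meta: "metacyclic_group G" and H: "group H" and h: "h \<in> iso G H"
  shows "metacyclic_group H"
proof -
  interpret H: group H by (rule H)
  obtain N where G: "group G" and N: "N \<lhd> G" and cN: "cyclic_group (G\<lparr>carrier := N\<rparr>)"
    and cQ: "cyclic_group (G Mod N)"
    using meta unfolding metacyclic_group_def by blast
  interpret G: group G by (rule G)
  interpret N: normal N G by (rule N)
  have surj: "h ` carrier G = carrier H"
    using h by (simp add: iso_iff)
  have hom: "h \<in> hom G H"
    using h by (simp add: iso_def)
  interpret h: group_hom G H h
    by unfold_locales (rule hom)
  have sub: "subgroup (h ` N) H"
    using N.subgroup_axioms h.subgroup_img_is_subgroup by blast
  have nor: "h ` N \<lhd> H"
  proof (rule H.normal_invI[OF sub])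
    fix y n assume "y \<in> carrier H" "n \<in> h ` N"
    then obtain x m where x: "x \<in> carrier G" "y = h x" and m: "m \<in> N" "n = h m"
      using surj by blast
    have "y \<otimes>\<^bsub>H\<^esub> n \<otimes>\<^bsub>H\<^esub> inv\<^bsub>H\<^esub> y = h (x \<otimes>\<^bsub>G\<^esub> m \<otimes>\<^bsub>G\<^esub> inv\<^bsub>G\<^esub> x)"
      using x m N.subset by (auto simp: subset_iff)
    then show "y \<otimes>\<^bsub>H\<^esub> n \<otimes>\<^bsub>H\<^esub> inv\<^bsub>H\<^esub> y \<in> h ` N"
      using N.inv_op_closed2[OF x(1) m(1)] by (metis imageI)
  qed
  have img_mult: "h ` (A <#>\<^bsub>G\<^esub> B) = h ` A <#>\<^bsub>H\<^esub> h ` B"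
    if "A \<subseteq> carrier G" "B \<subseteq> carrier G" for A B
    using that by (force simp: set_mult_def subset_iff)
  have img_coset: "h ` (N #>\<^bsub>G\<^esub> x) = h ` N #>\<^bsub>H\<^esub> h x" if "x \<in> carrier G" for x
    using that N.subset by (force simp: r_coset_def subset_iff)
  have cN': "cyclic_group (H\<lparr>carrier := h ` N\<rparr>)"
  proof (rule group.cyclic_group_epimorphic_image)
    show "h \<in> epi (G\<lparr>carrier := N\<rparr>) (H\<lparr>carrier := h ` N\<rparr>)"
      using N.subset by (auto simp: epi_def hom_def subset_iff)
    show "group (G\<lparr>carrier := N\<rparr>)" "group (H\<lparr>carrier := h ` N\<rparr>)"
      using N.subgroup_is_group G sub subgroup.subgroup_is_group H by blast+
  qed (rule cN)
  have cQ': "cyclic_group (H Mod (h ` N))"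
  proof (rule group.cyclic_group_epimorphic_image)
    show "(\<lambda>C. h ` C) \<in> epi (G Mod N) (H Mod (h ` N))"
    proof -
      have carr: "(\<lambda>C. h ` C) ` carrier (G Mod N) = carrier (H Mod (h ` N))"
      proof -
        have "(\<lambda>C. h ` C) ` carrier (G Mod N) = (\<lambda>x. h ` N #>\<^bsub>H\<^esub> h x) ` carrier G"
          by (auto simp: FactGroup_def RCOSETS_def img_coset image_iff)
        also have "\<dots> = (\<lambda>y. h ` N #>\<^bsub>H\<^esub> y) ` carrier H"
          unfolding surj[symmetric] image_image ..
        also have "\<dots> = carrier (H Mod (h ` N))"
          by (auto simp: FactGroup_def RCOSETS_def)
        finally show ?thesis .
      qed
      have "(\<lambda>C. h ` C) \<in> hom (G Mod N) (H Mod (h ` N))"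
      proof (rule homI)
        fix A assume "A \<in> carrier (G Mod N)"
        then show "h ` A \<in> carrier (H Mod (h ` N))" using carr by blast
      next
        fix A B assume "A \<in> carrier (G Mod N)" "B \<in> carrier (G Mod N)"
        then have "A \<subseteq> carrier G" "B \<subseteq> carrier G"
          using N.rcosets_carrier[OF G]
          by (auto simp: FactGroup_def)
        then show "h ` (A \<otimes>\<^bsub>G Mod N\<^esub> B) = h ` A \<otimes>\<^bsub>H Mod (h ` N)\<^esub> h ` B"
          using img_mult by (simp add: FactGroup_def)
      qed
      with carr show ?thesis by (simp add: epi_def)
    qed
    show "group (G Mod N)" "group (H Mod (h ` N))"
      using N.factorgroup_is_group nor normal.factorgroup_is_group by blast+
  qed (rule cQ)
  show ?thesis
    unfolding metacyclic_group_def using H nor cN' cQ' by blast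
qed

lemma Cay_transfer_nat:
  fixes G :: "('g, 'x) monoid_scheme"
  assumes G: "group G" and S: "connection_set G S"
    and fin: "simple_graph \<Gamma>" and iso: "isomorphic_graphs \<Gamma> (Cay G S)"
  obtains H :: "nat monoid" and h T where "group H" "h \<in> iso G H" "connection_set H T"
    "isomorphic_graphs \<Gamma> (Cay H T)"
proof -
  interpret G: group G by (rule G)
  have "finite (carrier G)"
    using fin iso bij_betw_finite
    unfolding simple_graph_def isomorphic_graphs_def graph_isomorphism_def Cay_def by fastforce
  then obtain h :: "'g \<Rightarrow> nat" where inj: "inj_on h (carrier G)"
    using finite_imp_inj_to_nat_seg by blast
  define H where "H = image_group h G"
  have h: "h \<in> iso G H" and H: "group H"
    using inj_imp_image_group_iso[OF inj] G.inj_imp_image_group_is_group[OF inj]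
    by (simp_all add: H_def)
  interpret H: group H by (rule H)
  have bij: "bij_betw h (carrier G) (carrier H)" and hom: "h \<in> hom G H"
    using h by (simp_all add: iso_def)
  interpret h: group_hom G H h
    by unfold_locales (rule hom)
  have SG: "S \<subseteq> carrier G" using S by (auto simp: connection_set_def)
  have T: "connection_set H (h ` S)"
    unfolding connection_set_def
  proof (intro conjI ballI subsetI)
    fix x assume "x \<in> h ` S"
    then obtain s where s: "s \<in> S" "x = h s" by blast
    with S have "s \<in> carrier G" "s \<noteq> \<one>\<^bsub>G\<^esub>" by (auto simp: connection_set_def)
    then have "h s \<noteq> h \<one>\<^bsub>G\<^esub>" using inj G.one_closed by (metis inj_onD)
    with s \<open>s \<in> carrier G\<close> show "x \<in> carrier H - {\<one>\<^bsub>H\<^esub>}" by simp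
  next
    fix x assume "x \<in> h ` S"
    then obtain s where s: "s \<in> S" "x = h s" by blast
    then have "inv\<^bsub>H\<^esub> x = h (inv\<^bsub>G\<^esub> s)" using SG by (simp add: subset_iff)
    with s S show "inv\<^bsub>H\<^esub> x \<in> h ` S" by (simp add: connection_set_def)
  qed
  have E: "edges (Cay H (h ` S)) = (\<lambda>e. h ` e) ` edges (Cay G S)"
  proof -
    have mult: "h (s \<otimes>\<^bsub>G\<^esub> g) = h s \<otimes>\<^bsub>H\<^esub> h g" if "g \<in> carrier G" "s \<in> S" for g s
      using that SG by (simp add: subset_iff)
    have "edges (Cay H (h ` S)) = {{h g, h s \<otimes>\<^bsub>H\<^esub> h g} | g s. g \<in> carrier G \<and> s \<in> S}"
      unfolding Cay_def bij_betw_imp_surj_on[OF bij, symmetric] by auto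
    also have "\<dots> = {h ` {g, s \<otimes>\<^bsub>G\<^esub> g} | g s. g \<in> carrier G \<and> s \<in> S}"
      by (intro Collect_cong ex_cong1) (auto simp: mult)
    also have "\<dots> = (\<lambda>e. h ` e) ` edges (Cay G S)"
      unfolding Cay_def by (simp only: ugraph.simps) blast
    finally show ?thesis .
  qed
  have sub: "e \<subseteq> carrier G" if "e \<in> edges (Cay G S)" for e
    using that SG by (auto simp: Cay_def)
  have "graph_isomorphism (Cay G S) (Cay H (h ` S)) h"
    unfolding graph_isomorphism_def
  proof (intro conjI ballI)
    show "bij_betw h (verts (Cay G S)) (verts (Cay H (h ` S)))"
      using bij by (simp add: Cay_def)
  next
    fix u v assume "u \<in> verts (Cay G S)" "v \<in> verts (Cay G S)"
    then have "{u, v} \<subseteq> carrier G" by (simp add: Cay_def)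
    then have "h ` {u, v} \<in> (\<lambda>e. h ` e) ` edges (Cay G S) \<longleftrightarrow> {u, v} \<in> edges (Cay G S)"
      using sub inj_on_image_eq_iff[OF inj] by (auto simp del: image_insert)
    then show "{u, v} \<in> edges (Cay G S) \<longleftrightarrow> {h u, h v} \<in> edges (Cay H (h ` S))"
      by (simp add: E)
  qed
  then have "isomorphic_graphs \<Gamma> (Cay H (h ` S))"
    using iso isomorphic_graphs_trans unfolding isomorphic_graphs_def by blast
  with that H h T show thesis by blast
qed

lemma Cayley_graphI:
  fixes G :: "('g, 'x) monoid_scheme"
  assumes simple: "simple_graph \<Gamma>" and G: "group G" and S: "connection_set G S"
    and iso: "isomorphic_graphs \<Gamma> (Cay G S)"
  shows "Cayley_graph \<Gamma>"
proof -
  obtain H :: "nat monoid" and h T where "group H" "connection_set H T"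
    "isomorphic_graphs \<Gamma> (Cay H T)"
    by (rule Cay_transfer_nat[OF G S simple iso])
  with simple show ?thesis
    unfolding Cayley_graph_def by blast
qed

lemma weak_metacirculant_Cayley_graphI:
  fixes G :: "('g, 'x) monoid_scheme"
  assumes simple: "simple_graph \<Gamma>" and G: "metacyclic_group G" and S: "connection_set G S"
    and iso: "isomorphic_graphs \<Gamma> (Cay G S)"
  shows "weak_metacirculant_Cayley_graph \<Gamma>"
proof -
  have "group G" using G by (simp add: metacyclic_group_def)
  then obtain H :: "nat monoid" and h T where "group H" "h \<in> Group.iso G H"
    "connection_set H T" "isomorphic_graphs \<Gamma> (Cay H T)"
    by (rule Cay_transfer_nat[OF _ S simple iso])
  moreover from this have "metacyclic_group H"
    using metacyclic_group_iso[OF G] by blast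
  ultimately show ?thesis
    using simple unfolding weak_metacirculant_Cayley_graph_def by blast
qed

end

theory Submission
  imports Defs
begin

text \<open>
  Put \<open>Q = p\<^bsup>m-1\<^esup>\<close>, \<open>M = p\<^bsup>m\<^esup>\<close> and \<open>N = p\<^bsup>n\<^esup>\<close>.  Then \<open>\<lambda>\<^bsup>N\<^esup>\<close> is \<open>1\<close> modulo \<open>Q\<close> but not modulo \<open>M\<close>, and adjacency inside
  a layer depends only on the columns modulo \<open>Q\<close>.  The maps \<open>(j, i) \<mapsto> (\<lambda>\<^bsup>b\<^esup> j + c, i + b)\<close> form a
  transitive metacyclic group of order \<open>p M N\<close>, and \<open>C\<^sub>p \<times> (C\<^sub>Q \<rtimes> C\<^sub>N)\<close> acts regularly.

  Every automorphism permutes the columns, the layers and the fibres (same layer, columns congruent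
  modulo \<open>Q\<close>), because fibres are visible from common neighbourhoods and a layer edge is one that
  extends to the whole fibre of its end.  Each layer modulo its fibres is a cycle, so an automorphism
  acts as \<open>j \<mapsto> \<plusminus>\<lambda>\<^bsup>b\<^esup> j + c\<close> on columns modulo \<open>Q\<close> and as \<open>i \<mapsto> i + b\<close> on layers (a reflection of the
  layers would force \<open>\<lambda>\<^sup>2 = \<plusminus>1\<close> modulo \<open>Q\<close>).  In a regular group \<open>G\<close> every element is a square, so the
  sign is \<open>+\<close> and \<open>G\<close> is an extension of \<open>C\<^sub>Q \<rtimes> C\<^sub>N\<close> by a central subgroup \<open>K\<close> of order \<open>p\<close>.  Let \<open>s, t\<close>
  in \<open>G\<close> move \<open>(0, 0)\<close> to \<open>(0, 1)\<close> and \<open>(1, 0)\<close>.  Regularity gives \<open>s\<^bsup>N\<^esup> = 1\<close>.  If \<open>t\<^bsup>Q\<^esup> \<noteq> 1\<close>, then \<open>t\<close> has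
  order \<open>M\<close> and \<open>s\<close> conjugates it to \<open>t\<^bsup>\<mu>\<^esup>\<close> with \<open>\<mu> = \<lambda>\<close> modulo \<open>Q\<close>, whence \<open>\<lambda>\<^bsup>N\<^esup> = \<mu>\<^bsup>N\<^esup> = 1\<close> modulo \<open>M\<close>, which
  is false.  So \<open>t\<^bsup>Q\<^esup> = 1\<close>, and \<open>K\<close>, \<open>t\<^bsup>Q/p\<^esup>\<close> and \<open>s\<^bsup>N/p\<^esup>\<close> generate an elementary abelian group of order
  \<open>p\<^sup>3\<close>, which a metacyclic group cannot contain.
\<close>

section \<open>Arithmetic modulo prime powers\<close>

text \<open>Fermat's little theorem, which as \<open>x ^ p = x\<close> also covers multiples of
  \<open>p\<close>, is iterated. It turns information about \<open>p\<close>-power exponents into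
  residues modulo \<open>p\<close>, for \<open>lam\<close> and for conjugation on a group of order
  \<open>p\<close>.\<close>

lemma fermat_prime_power:
  fixes p a k :: nat
  assumes "Factorial_Ring.prime p"
  shows "[a ^ (p ^ k) = a] (mod p)"
proof (induction k)
  case (Suc k)
  have *: "[x ^ p = x] (mod p)" for x
  proof (cases "p dvd x")
    case True
    then have "p dvd x ^ p"
      using prime_gt_0_nat[OF assms] by (meson dvd_power dvd_trans)
    with True show ?thesis by (simp add: cong_def mod_0_imp_dvd)
  next
    case False
    have "[x ^ (p - 1) * x = 1 * x] (mod p)"
      by (intro cong_mult cong_refl fermat_theorem assms False)
    then show ?thesis
      using prime_gt_0_nat[OF assms] by (simp add: power_Suc2[symmetric] del: power_Suc)
  qed
  have "[(a ^ (p ^ k)) ^ p = a ^ (p ^ k)] (mod p)" by (rule *)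
  with Suc show ?case
    by (metis cong_trans power_Suc2 power_mult)
qed simp

lemma power_one_plus_mult_cong:
  fixes p w :: int
  shows "[(1 + p * w) ^ i = 1 + int i * p * w] (mod p\<^sup>2)"
proof (induction i)
  case (Suc i)
  have "[(1 + p * w) ^ Suc i = (1 + p * w) * (1 + int i * p * w)] (mod p\<^sup>2)"
    using Suc by (simp add: cong_scalar_left)
  also have "(1 + p * w) * (1 + int i * p * w) = (1 + int (Suc i) * p * w) + int i * w\<^sup>2 * p\<^sup>2"
    by (simp add: algebra_simps power2_eq_square)
  also have "[\<dots> = 1 + int (Suc i) * p * w] (mod p\<^sup>2)"
    by (simp add: cong_def)
  finally show ?case .
qed simp

text \<open>Factor \<open>a ^ p - 1 = (a - 1) * S\<close> with \<open>S\<close> the geometric sum.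
  Modulo \<open>p\<^sup>2\<close> the sum is \<open>p\<close>, so \<open>S\<close> absorbs exactly
  one factor \<open>p\<close> and the rest must divide \<open>a - 1\<close>.\<close>

lemma cong_one_prime_power_descend:
  fixes p k :: nat and a :: int
  assumes p: "Factorial_Ring.prime p" "odd p" and a: "[a = 1] (mod int p)"
    and cong: "[a ^ p = 1] (mod int p ^ Suc k)"
  shows "[a = 1] (mod int p ^ k)"
proof -
  have p0: "int p \<noteq> 0" using prime_gt_0_nat[OF p(1)] by simp
  obtain w where w: "a = 1 + int p * w"
    using a by (metis add.commute cong_iff_dvd_diff diff_add_cancel dvdE)
  obtain h where h: "p = 2 * h + 1" using p(2) by (metis oddE)
  define S where "S = (\<Sum>i<p. a ^ i)"
  have "[S = (\<Sum>i<p. 1 + int i * int p * w)] (mod (int p)\<^sup>2)"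
    unfolding S_def w by (intro cong_sum power_one_plus_mult_cong)
  also have "(\<Sum>i<p. 1 + int i * int p * w) = int p + (\<Sum>i<p. int i) * int p * w"
    by (simp add: sum.distrib sum_distrib_right)
  \<comment> \<open>Oddness of \<open>p\<close> enters here: the sum is a multiple of
    \<open>p\<close>, so the first-order term of \<open>S\<close> vanishes modulo
    \<open>p\<^sup>2\<close>.\<close>
  also have "(\<Sum>i<p. int i) = int p * int h"
  proof -
    have "2 * (\<Sum>i<j. int i) = int j * (int j - 1)" for j
      by (induction j) (simp_all add: algebra_simps)
    from this[of p] show ?thesis by (simp add: h)
  qed
  finally have "(int p)\<^sup>2 dvd S - (int p + int p * int h * int p * w)"
    by (simp add: cong_iff_dvd_diff)
  then obtain v where "S - (int p + int p * int h * int p * w) = (int p)\<^sup>2 * v" ..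
  then have S: "S = int p * (1 + int p * (int h * w + v))"
    by (simp add: algebra_simps power2_eq_square)
  have "a ^ p - 1 = (a - 1) * S"
    unfolding S_def by (rule power_diff_1_eq)
  then have "int p ^ Suc k dvd int p * ((a - 1) * (1 + int p * (int h * w + v)))"
    using cong by (simp add: S cong_iff_dvd_diff mult_ac)
  then have "int p ^ k dvd (a - 1) * (1 + int p * (int h * w + v))"
    using p0 by simp
  moreover have "coprime (int p ^ k) (1 + int p * (int h * w + v))"
  proof -
    have "coprime (int p) (1 + int p * (int h * w + v))"
      by (rule coprimeI) (metis dvd_add_left_iff dvd_mult2)
    then show ?thesis by simp
  qed
  ultimately show ?thesis
    by (metis cong_iff_dvd_diff coprime_dvd_mult_left_iff)
qed

text \<open>One \<open>p\<close>-th power gains one factor \<open>p\<close>, because the cofactor of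
  \<open>a - b\<close> in \<open>a ^ p - b ^ p\<close> is \<open>p * b ^ (p - 1)\<close> modulo
  \<open>p\<close>. Only a single gain is claimed, so the induction may discard what earlier powers
  gained.\<close>

lemma power_cong_prime_power:
  fixes p k n :: nat and a b :: int
  assumes ab: "[a = b] (mod int p ^ k)" and k: "k > 0" "n > 0"
  shows "[a ^ (p ^ n) = b ^ (p ^ n)] (mod int p ^ Suc k)"
proof -
  have step: "[a ^ p = b ^ p] (mod int p ^ Suc k)"
    if ab: "[a = b] (mod int p ^ k)" for a b :: int
  proof -
    have dk: "int p dvd int p ^ k" using k by (simp add: dvd_power)
    have "[(\<Sum>i<p. b ^ (p - Suc i) * a ^ i) = (\<Sum>i<p. b ^ (p - Suc i) * b ^ i)] (mod int p)"
      using cong_dvd_modulus[OF ab dk] by (intro cong_sum cong_mult cong_refl cong_pow)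
    also have "(\<Sum>i<p. b ^ (p - Suc i) * b ^ i) = int p * b ^ (p - 1)"
      by (simp add: power_add[symmetric])
    also have "[\<dots> = 0] (mod int p)" by (simp add: cong_def)
    finally have "int p dvd (\<Sum>i<p. b ^ (p - Suc i) * a ^ i)"
      by (simp add: cong_0_iff)
    moreover have "int p ^ k dvd a - b" using ab by (simp add: cong_iff_dvd_diff)
    ultimately have "int p ^ k * int p dvd (a - b) * (\<Sum>i<p. b ^ (p - Suc i) * a ^ i)"
      by (rule mult_dvd_mono[rotated])
    then show ?thesis
      by (simp add: power_diff_sumr2 cong_iff_dvd_diff mult.commute)
  qed
  show ?thesis
    using k(2)
  proof (induction n rule: nat_induct_non_zero)
    case 1
    show ?case using step[OF ab] by simp
  next
    case (Suc n)
    have "[a ^ (p ^ n) = b ^ (p ^ n)] (mod int p ^ k)"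
      by (rule cong_pow[OF ab])
    from step[OF this] show ?case
      by (simp add: power_mult[symmetric] mult.commute)
  qed
qed

section \<open>Elements of prime order in metacyclic groups\<close>

lemma (in group) cyclic_group_card_roots_le:
  assumes cyc: "cyclic_group G" and fin: "finite (carrier G)" and k: "k > 0"
  shows "card {x \<in> carrier G. x [^] (k::nat) = \<one>} \<le> k"
proof -
  obtain g where g: "g \<in> carrier G" and gen: "carrier G = range (\<lambda>i::int. g [^] i)"
    using cyc cyclic_group by blast
  define d where "d = ord g"
  have d: "d > 0" unfolding d_def using ord_ge_1[OF fin g] by simp
  have ex: "\<exists>i q. i < d \<and> q < k \<and> x = g [^] i \<and> i * k = q * d"
    if x: "x \<in> carrier G" "x [^] k = \<one>" for x
  proof -
    obtain a :: int where a: "x = g [^] a" using x(1) gen by blast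
    define i where "i = nat (a mod int d)"
    have i: "i < d" unfolding i_def using d by (simp add: nat_less_iff)
    have "int d dvd a - int i" unfolding i_def using d by (simp add: minus_mod_eq_mult_div)
    then have "x = g [^] int i"
      using a int_pow_eq[OF g, of "int i" a] unfolding d_def by simp
    then have x': "x = g [^] i" by (simp add: int_pow_int)
    then have "g [^] (i * k) = \<one>" using x(2) g by (simp add: nat_pow_pow)
    then have "d dvd i * k" unfolding d_def using g pow_eq_id by blast
    then obtain q where q: "i * k = q * d" by (metis dvdE mult.commute)
    have "q * d < k * d" using q i k by (metis mult.commute mult_less_mono1)
    then have "q < k" by simp
    with i x' q show ?thesis by blast
  qed
  \<comment> \<open>A root \<open>g [^] i\<close> is labelled by the quotient of
    \<open>i * k\<close> by the order \<open>d\<close>; the label determines \<open>i\<close>, and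
    only \<open>k\<close> labels are available.\<close>
  define f where "f x = (SOME q. q < k \<and> (\<exists>i. x = g [^] i \<and> i * k = q * d))" for x
  have f: "f x < k \<and> (\<exists>i. x = g [^] i \<and> i * k = f x * d)"
    if x: "x \<in> carrier G" "x [^] k = \<one>" for x
    unfolding f_def by (rule someI_ex) (use ex[OF x] in blast)
  have "inj_on f {x \<in> carrier G. x [^] k = \<one>}"
  proof (rule inj_onI)
    fix x y assume "x \<in> {x \<in> carrier G. x [^] k = \<one>}" "y \<in> {x \<in> carrier G. x [^] k = \<one>}"
      and eq: "f x = f y"
    then obtain i j where "x = g [^] i" "i * k = f x * d" "y = g [^] j" "j * k = f y * d"
      using f by blast
    with eq k show "x = y" by (metis mult_right_cancel less_numeral_extra(3))
  qed
  then show ?thesis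
    using card_inj_on_le[of f _ "{..<k}"] f by fastforce
qed

text \<open>The images of \<open>E\<close> in the cyclic quotient are roots there, so at most
  \<open>k\<close> cosets of \<open>N\<close> are met. Inside one coset, dividing by a fixed
  commuting root \<open>e\<close> gives roots in the cyclic group \<open>N\<close>, again at most
  \<open>k\<close>. For \<open>k = p\<close> this excludes elementary abelian subgroups of order
  \<open>p ^ 3\<close>.\<close>

lemma metacyclic_group_card_commuting_roots_le:
  fixes G (structure)
  assumes meta: "metacyclic_group G" and fin: "finite (carrier G)" and k: "k > 0"
    and E: "E \<subseteq> carrier G" and comm: "\<And>x y. x \<in> E \<Longrightarrow> y \<in> E \<Longrightarrow> x \<otimes> y = y \<otimes> x"
    and root: "\<And>x. x \<in> E \<Longrightarrow> x [^] (k::nat) = \<one>"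
  shows "card E \<le> k * k"
proof -
  obtain N where "group G" and N: "N \<lhd> G" and cN: "cyclic_group (G\<lparr>carrier := N\<rparr>)"
    and cQ: "cyclic_group (G Mod N)"
    using meta unfolding metacyclic_group_def by blast
  interpret group G by fact
  interpret N: normal N G by (rule N)
  interpret Q: group "G Mod N" by (rule N.factorgroup_is_group)
  interpret NG: group "G\<lparr>carrier := N\<rparr>" by (rule N.subgroup_is_group) (rule is_group)
  interpret pr: group_hom G "G Mod N" "\<lambda>x. N #> x"
    by unfold_locales (rule N.r_coset_hom_Mod)
  define W where "W = {w \<in> carrier (G Mod N). w [^]\<^bsub>G Mod N\<^esub> k = \<one>\<^bsub>G Mod N\<^esub>}"
  have finQ: "finite (carrier (G Mod N))"
    using fin by (auto simp: FactGroup_def RCOSETS_def)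
  have W: "card W \<le> k"
    unfolding W_def by (rule Q.cyclic_group_card_roots_le[OF cQ finQ k])
  have finN: "finite N" using fin N.subset by (rule finite_subset[rotated])
  define U where "U = {x \<in> N. x [^] k = \<one>}"
  have "card {x \<in> carrier (G\<lparr>carrier := N\<rparr>). x [^]\<^bsub>G\<lparr>carrier := N\<rparr>\<^esub> k = \<one>\<^bsub>G\<lparr>carrier := N\<rparr>\<^esub>} \<le> k"
    by (rule NG.cyclic_group_card_roots_le[OF cN _ k]) (simp add: finN)
  then have U: "card U \<le> k"
    unfolding U_def by (simp add: nat_pow_consistent[symmetric])
  have im: "(\<lambda>x. N #> x) ` E \<subseteq> W"
  proof
    fix w assume "w \<in> (\<lambda>x. N #> x) ` E"
    then obtain x where x: "x \<in> E" "w = N #> x" by blast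
    then have "x \<in> carrier G" using E by blast
    then have "w [^]\<^bsub>G Mod N\<^esub> k = N #> (x [^] k)" "w \<in> carrier (G Mod N)"
      using x pr.hom_nat_pow pr.hom_closed by simp_all
    then show "w \<in> W" unfolding W_def using root[OF x(1)] pr.hom_one by simp
  qed
  have fib: "card {x \<in> E. N #> x = w} \<le> k" if "w \<in> W" for w
  proof (cases "{x \<in> E. N #> x = w} = {}")
    case False
    then obtain e where e: "e \<in> E" "N #> e = w" by blast
    then have eG: "e \<in> carrier G" using E by blast
    have "inj_on (\<lambda>x. x \<otimes> inv e) {x \<in> E. N #> x = w}"
      using E eG by (intro inj_onI) (metis (no_types, lifting) inv_closed mem_Collect_eq right_cancel subsetD)
    moreover have "(\<lambda>x. x \<otimes> inv e) ` {x \<in> E. N #> x = w} \<subseteq> U"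
    proof clarify
      fix x assume x: "x \<in> E" "w = N #> x"
      then have xG: "x \<in> carrier G" using E by blast
      have "x \<in> N #> e"
        using e x xG rcos_self[OF xG N.subgroup_axioms] by simp
      then have 1: "x \<otimes> inv e \<in> N"
        using N.rcos_module_imp[OF is_group eG] by blast
      have "(x \<otimes> inv e) \<otimes> e = e \<otimes> (x \<otimes> inv e)"
        using comm[OF x(1) e(1)] xG eG by (metis inv_closed inv_solve_right' l_inv m_assoc m_closed r_one r_inv)
      then have "(x \<otimes> inv e) [^] k \<otimes> e [^] k = ((x \<otimes> inv e) \<otimes> e) [^] k"
        using xG eG by (intro pow_mult_distrib[symmetric]) auto
      also have "(x \<otimes> inv e) \<otimes> e = x" using xG eG by (simp add: m_assoc)
      finally have "(x \<otimes> inv e) [^] k = \<one>" using root x e xG eG by simp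
      with 1 show "x \<otimes> inv e \<in> U" unfolding U_def by simp
    qed
    moreover have "finite U" unfolding U_def using finN by simp
    ultimately show ?thesis using U card_inj_on_le le_trans by blast
  next
    case True
    show ?thesis unfolding True by simp
  qed
  have finW: "finite W" unfolding W_def using finQ by simp
  have "E = (\<Union>w\<in>W. {x \<in> E. N #> x = w})" using im by blast
  then have "card E \<le> (\<Sum>w\<in>W. card {x \<in> E. N #> x = w})"
    using card_UN_le[OF finW] by metis
  also have "\<dots> \<le> (\<Sum>w\<in>W. k)" by (rule sum_mono) (rule fib)
  also have "\<dots> \<le> k * k" using W by simp
  finally show ?thesis .
qed

section \<open>Extensions of a split metacyclic group\<close>

lemma nat_double_mod_eq_self:
  fixes b N :: nat
  assumes "b = (b + b) mod N" "b < N"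
  shows "b = 0"
  using assms by (cases "b + b < N") (auto simp: le_mod_geq)

lemma (in group) pow_eq_iff_cong:
  assumes "x \<in> carrier G"
  shows "x [^] (i::nat) = x [^] (j::nat) \<longleftrightarrow> [i = j] (mod ord x)"
proof -
  have "x [^] i = x [^] j \<longleftrightarrow> int (ord x) dvd int j - int i"
    using int_pow_eq[OF assms, of "int i" "int j"] by (simp add: int_pow_int)
  also have "\<dots> \<longleftrightarrow> [int j = int i] (mod int (ord x))"
    by (simp only: cong_iff_dvd_diff)
  finally show ?thesis by (metis cong_int_iff cong_sym_eq)
qed

lemma (in group) pow_eq_less_ord:
  assumes "x \<in> carrier G" "x [^] (i::nat) = x [^] (j::nat)" "i < ord x" "j < ord x"
  shows "i = j"
  using assms pow_eq_iff_cong by (metis cong_less_modulus_unique_nat)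

text \<open>Below, \<open>c x\<close> and \<open>b x\<close> are the column and the layer of the image of \<open>(0, 0)\<close> under \<open>x\<close>; together they
  are a homomorphism to \<open>C\<^sub>Q \<rtimes> C\<^sub>N\<close>, with kernel \<open>K\<close>.\<close>

locale crossed_hom = group G for G (structure) +
  fixes c :: "'a \<Rightarrow> int" and b :: "'a \<Rightarrow> nat" and Q l :: int and N :: nat
  assumes c_mult: "\<lbrakk>x \<in> carrier G; y \<in> carrier G\<rbrakk> \<Longrightarrow> [c (x \<otimes> y) = c x + l ^ b x * c y] (mod Q)"
    and b_mult: "\<lbrakk>x \<in> carrier G; y \<in> carrier G\<rbrakk> \<Longrightarrow> b (x \<otimes> y) = (b x + b y) mod N"
    and b_less: "x \<in> carrier G \<Longrightarrow> b x < N"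
begin

definition K where "K = {x \<in> carrier G. [c x = 0] (mod Q) \<and> b x = 0}"

lemma b_one: "b \<one> = 0"
  using nat_double_mod_eq_self[of "b \<one>" N] b_mult[of \<one> \<one>] b_less[of \<one>] by simp

lemma c_one: "[c \<one> = 0] (mod Q)"
  using c_mult[of \<one> \<one>] by (simp add: b_one cong_iff_dvd_diff)

lemma K_carrier: "x \<in> K \<Longrightarrow> x \<in> carrier G"
  and K_b: "x \<in> K \<Longrightarrow> b x = 0"
  and K_c: "x \<in> K \<Longrightarrow> [c x = 0] (mod Q)"
  by (simp_all add: K_def)

text \<open>This replaces the homomorphism theorem for the map to the semidirect product, which is
  never built as a group: the quotient \<open>x \<otimes> inv y\<close> has trivial column and
  layer.\<close>

lemma K_coset:
  assumes x: "x \<in> carrier G" and y: "y \<in> carrier G" and b: "b x = b y" and c: "[c x = c y] (mod Q)"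
  obtains k where "k \<in> K" "x = k \<otimes> y"
proof
  define k where "k = x \<otimes> inv y"
  have k: "k \<in> carrier G" using x y by (simp add: k_def)
  show xk: "x = k \<otimes> y" using x y by (simp add: k_def m_assoc)
  have "(b k + b y) mod N = b y" using b b_mult[OF k y] xk by simp
  then have "b k = 0"
    using b_less[OF k] b_less[OF y] by (cases "b k + b y < N") (auto simp: le_mod_geq)
  moreover from this have "[c k + c y = 0 + c y] (mod Q)"
    using c_mult[OF k y] c xk by (metis add.left_neutral cong_sym cong_trans mult_1 power_0)
  ultimately show "k \<in> K" using k unfolding K_def by (simp only: cong_add_rcancel) simp
qed

lemma c_pow:
  assumes "x \<in> carrier G" "b x = 0"
  shows "[c (x [^] (k::nat)) = int k * c x] (mod Q)" "b (x [^] k) = 0"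
proof -
  have "[c (x [^] k) = int k * c x] (mod Q) \<and> b (x [^] k) = 0"
  proof (induction k)
    case 0
    show ?case using c_one b_one by simp
  next
    case (Suc k)
    have "[c (x [^] Suc k) = c (x [^] k) + c x] (mod Q)"
      using c_mult[of "x [^] k" x] assms Suc by simp
    also have "[c (x [^] k) + c x = int k * c x + c x] (mod Q)"
      using Suc by (simp add: cong_add_rcancel)
    finally show ?case
      using Suc assms b_mult[of "x [^] k" x] by (simp add: algebra_simps)
  qed
  then show "[c (x [^] k) = int k * c x] (mod Q)" "b (x [^] k) = 0" by blast+
qed

lemma b_pow:
  assumes "x \<in> carrier G"
  shows "b (x [^] (k::nat)) = (k * b x) mod N"
proof (induction k)
  case (Suc k)
  then show ?case using assms b_mult[of "x [^] k" x] by (simp add: mod_simps add.commute)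
qed (simp add: b_one)

lemma c_pow_zero:
  assumes "x \<in> carrier G" "[c x = 0] (mod Q)"
  shows "[c (x [^] (k::nat)) = 0] (mod Q)"
proof (induction k)
  case (Suc k)
  have "[c (x [^] Suc k) = c (x [^] k) + l ^ b (x [^] k) * c x] (mod Q)"
    using c_mult[of "x [^] k" x] assms by simp
  also have "[c (x [^] k) + l ^ b (x [^] k) * c x = 0 + l ^ b (x [^] k) * 0] (mod Q)"
    using Suc assms(2) by (intro cong_add cong_mult cong_refl)
  finally show ?case by simp
qed (simp add: c_one)

lemma K_subgroup: "subgroup K G"
proof (rule subgroupI)
  show "K \<subseteq> carrier G" by (auto simp: K_def)
  show "K \<noteq> {}" using c_one b_one by (auto simp: K_def)
next
  fix k assume k: "k \<in> K"
  have "b \<one> = b k" "[c \<one> = c k] (mod Q)"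
    using k b_one c_one by (auto simp: K_def cong_def)
  then obtain k' where k': "k' \<in> K" "\<one> = k' \<otimes> k"
    using K_coset[of \<one> k] k K_carrier by blast
  then have "inv k = k'" using k K_carrier by (metis inv_equality)
  then show "inv k \<in> K" using k' by simp
next
  fix x y assume xy: "x \<in> K" "y \<in> K"
  then have "[c (x \<otimes> y) = c x + c y] (mod Q)" using c_mult[of x y] by (simp add: K_def)
  also have "[c x + c y = 0 + 0] (mod Q)" using xy by (intro cong_add) (auto simp: K_def)
  finally show "x \<otimes> y \<in> K"
    using xy b_mult[of x y] by (simp add: K_def)
qed

text \<open>Multiplying \<open>x\<close> by an element of \<open>K\<close> on the right changes
  neither its layer nor its column modulo \<open>Q\<close>, so \<open>K_coset\<close> applies to
  \<open>x \<otimes> k\<close> and \<open>x\<close>.\<close>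

lemma K_normal:
  assumes x: "x \<in> carrier G" and k: "k \<in> K"
  obtains k' where "k' \<in> K" "x \<otimes> k = k' \<otimes> x"
proof -
  have kG: "k \<in> carrier G" using k K_carrier by blast
  have "[c (x \<otimes> k) = c x + l ^ b x * c k] (mod Q)" by (rule c_mult[OF x kG])
  also have "[c x + l ^ b x * c k = c x + l ^ b x * 0] (mod Q)"
    using k by (intro cong_add cong_mult cong_refl) (simp add: K_def)
  finally have "[c (x \<otimes> k) = c x] (mod Q)" by simp
  moreover have "b (x \<otimes> k) = b x" using b_mult[OF x kG] k b_less[OF x] by (simp add: K_def)
  ultimately show thesis using K_coset[of "x \<otimes> k" x] x kG that by blast
qed

lemma prime_K_generated:
  assumes p: "Factorial_Ring.prime (card K)" and z: "z \<in> K" "z \<noteq> \<one>"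
  shows "ord z = card K" "z [^] card K = \<one>" "K = (\<lambda>i::nat. z [^] i) ` {..<card K}"
proof -
  have zG: "z \<in> carrier G" using z K_carrier by blast
  interpret K: group "G\<lparr>carrier := K\<rparr>"
    by (rule subgroup.subgroup_is_group[OF K_subgroup is_group])
  have finK: "finite K" using p by (metis card.infinite not_prime_0)
  show zp: "z [^] card K = \<one>"
    using K.pow_order_eq_1[of z] z(1) by (simp add: order_def nat_pow_consistent[symmetric])
  then have "ord z dvd card K" using pow_eq_id[OF zG] by blast
  moreover have "ord z \<noteq> 1" using z(2) ord_eq_1[OF zG] by simp
  ultimately show o: "ord z = card K" using p by (metis prime_nat_iff)
  have "inj_on (\<lambda>i::nat. z [^] i) {..<card K}"
    using pow_eq_less_ord[OF zG] o by (intro inj_onI) simp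
  moreover have "(\<lambda>i::nat. z [^] i) ` {..<card K} \<subseteq> K"
  proof -
    have "z [^] i \<in> K" for i :: nat
      using K.nat_pow_closed[of z i] z(1) by (simp add: nat_pow_consistent[symmetric])
    then show ?thesis by blast
  qed
  ultimately show "K = (\<lambda>i::nat. z [^] i) ` {..<card K}"
    using finK by (metis card_image card_lessThan card_subset_eq)
qed

text \<open>Each conjugation by \<open>x\<close> multiplies the exponent by \<open>r\<close>. Taking
  for \<open>k\<close> an exponent that kills \<open>x\<close> gives a congruence for a power of
  \<open>r\<close> modulo the order of \<open>z\<close>.\<close>

lemma conj_pow:
  assumes G: "x \<in> carrier G" "z \<in> carrier G" and eq: "x \<otimes> z = z [^] (r::nat) \<otimes> x"
  shows "x [^] (k::nat) \<otimes> z = z [^] (r ^ k) \<otimes> x [^] k"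
proof -
  have 1: "x \<otimes> z [^] i = z [^] (r * i) \<otimes> x" for i :: nat
  proof (induction i)
    case (Suc i)
    have "x \<otimes> z [^] Suc i = (x \<otimes> z [^] i) \<otimes> z" using G by (simp add: m_assoc)
    also have "\<dots> = z [^] (r * i) \<otimes> (x \<otimes> z)" using G Suc by (simp add: m_assoc)
    also have "\<dots> = (z [^] (r * i) \<otimes> z [^] r) \<otimes> x" using G eq by (simp add: m_assoc)
    also have "\<dots> = z [^] (r * Suc i) \<otimes> x" using G by (simp add: nat_pow_mult add.commute)
    finally show ?case .
  qed (use G in simp)
  show ?thesis
  proof (induction k)
    case (Suc k)
    have S: "x [^] Suc k = x \<otimes> x [^] k" using G(1) by (rule nat_pow_Suc2)
    then have "x [^] Suc k \<otimes> z = x \<otimes> (x [^] k \<otimes> z)"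
      using G by (simp only: S m_assoc nat_pow_closed)
    also have "\<dots> = (x \<otimes> z [^] (r ^ k)) \<otimes> x [^] k" using G Suc by (simp add: m_assoc)
    also have "\<dots> = z [^] (r ^ Suc k) \<otimes> x [^] Suc k"
      using G by (simp only: S 1 m_assoc nat_pow_closed power_Suc)
    finally show ?case .
  qed (use G in simp)
qed

text \<open>Conjugation by \<open>x\<close> raises a generator of \<open>K\<close> to some power
  \<open>r\<close>. As \<open>x\<close> has \<open>p\<close>-power order, a \<open>p\<close>-power
  of \<open>r\<close> is 1 modulo \<open>p\<close>, and by Fermat so is \<open>r\<close>
  itself.\<close>

lemma prime_K_central:
  assumes p: "Factorial_Ring.prime (card K)" and ord: "order G = card K ^ e"
    and x: "x \<in> carrier G" and z: "z \<in> K"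
  shows "x \<otimes> z = z \<otimes> x"
proof (cases "z = \<one>")
  case False
  have zG: "z \<in> carrier G" using z K_carrier by blast
  obtain z' where "z' \<in> K" "x \<otimes> z = z' \<otimes> x" using K_normal[OF x z] .
  moreover from this obtain r :: nat where "z' = z [^] r"
    using prime_K_generated(3)[OF p z False] by (metis imageE)
  ultimately have r: "x \<otimes> z = z [^] r \<otimes> x" by simp
  have "z = z [^] (r ^ (card K ^ e))"
    using conj_pow[OF x zG r, of "card K ^ e"] pow_order_eq_1[OF x] ord zG by simp
  then have "[r ^ (card K ^ e) = 1] (mod card K)"
    using pow_eq_iff_cong[OF zG, of "r ^ (card K ^ e)" 1] zG prime_K_generated(1)[OF p z False]
    by simp
  then have "[r = 1] (mod card K)"
    using fermat_prime_power[OF p] cong_sym cong_trans by blast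
  then have "z [^] r = z"
    using pow_eq_iff_cong[OF zG, of r 1] zG prime_K_generated(1)[OF p z False] by simp
  with r show ?thesis by simp
qed (use x in simp)

end

section \<open>Products of commuting elements\<close>

lemma (in group) commute_mult:
  assumes "x \<in> carrier G" "y \<in> carrier G" "z \<in> carrier G" "x \<otimes> z = z \<otimes> x" "y \<otimes> z = z \<otimes> y"
  shows "(x \<otimes> y) \<otimes> z = z \<otimes> (x \<otimes> y)"
  using assms by (metis m_assoc)

lemma (in group) commute_pow:
  assumes "x \<in> carrier G" "z \<in> carrier G" "x \<otimes> z = z \<otimes> x"
  shows "x [^] (k::nat) \<otimes> z = z \<otimes> x [^] k"
  using assms by (induction k) (auto intro: commute_mult)

text \<open>Supplies commuting roots for the rank-three subgroup; that distinct exponent triples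
  below \<open>p\<close> give distinct products is shown where the three elements are
  chosen.\<close>

lemma (in group) commuting_triple_products:
  assumes G: "x \<in> carrier G" "y \<in> carrier G" "z \<in> carrier G"
    and comm: "x \<otimes> y = y \<otimes> x" "x \<otimes> z = z \<otimes> x" "y \<otimes> z = z \<otimes> y"
    and root: "x [^] (k::nat) = \<one>" "y [^] k = \<one>" "z [^] k = \<one>"
  defines "w \<equiv> \<lambda>(i::nat, j::nat, h::nat). x [^] i \<otimes> y [^] j \<otimes> z [^] h"
  shows "w u \<in> carrier G" "w u \<otimes> w v = w v \<otimes> w u" "w u [^] k = \<one>"
proof -
  obtain i j h where u: "u = (i, j, h)" by (metis prod_cases3)
  obtain i' j' h' where v: "v = (i', j', h')" by (metis prod_cases3)
  show "w u \<in> carrier G" using G by (simp add: w_def u)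
  have pow_comm: "a [^] i \<otimes> a' [^] j = a' [^] j \<otimes> a [^] i"
    if "a \<in> carrier G" "a' \<in> carrier G" "a \<otimes> a' = a' \<otimes> a" for a a' and i j :: nat
    using that commute_pow[of a a' i] commute_pow[of a' "a [^] i" j] by simp
  have gen: "a [^] i \<otimes> b [^] j = b [^] j \<otimes> a [^] i"
    if "a \<in> {x, y, z}" "b \<in> {x, y, z}" for a b and i j :: nat
    using that pow_comm[of a b] G comm by auto
  have c1: "(x [^] i \<otimes> y [^] j \<otimes> z [^] h) \<otimes> a [^] l = a [^] l \<otimes> (x [^] i \<otimes> y [^] j \<otimes> z [^] h)"
    if "a \<in> {x, y, z}" for a and i j h l :: nat
    using that G by (intro commute_mult gen) auto
  show "w u \<otimes> w v = w v \<otimes> w u"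
    unfolding w_def u v prod.case
  proof (rule commute_mult[symmetric, OF _ _ _ commute_mult])
  qed (use G in \<open>auto intro!: c1[symmetric]\<close>)
  have "w u [^] k = (x [^] i \<otimes> y [^] j) [^] k \<otimes> (z [^] h) [^] k"
    unfolding w_def u prod.case using G by (intro pow_mult_distrib commute_mult gen) auto
  also have "(x [^] i \<otimes> y [^] j) [^] k = (x [^] i) [^] k \<otimes> (y [^] j) [^] k"
    using G by (intro pow_mult_distrib gen) auto
  also have "(a [^] i) [^] k = \<one>" if "a \<in> carrier G" "a [^] k = \<one>" for a and i :: nat
    using that by (metis mult.commute nat_pow_one nat_pow_pow)
  ultimately show "w u [^] k = \<one>" using G root by simp
qed

lemma (in group) commute_shift_pow:
  assumes "x \<in> carrier G" "a \<in> carrier G" "d \<in> carrier G" "x \<otimes> a = d \<otimes> x"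
  shows "x \<otimes> a [^] (k::nat) = d [^] k \<otimes> x"
proof (induction k)
  case (Suc k)
  have "x \<otimes> a [^] Suc k = (x \<otimes> a [^] k) \<otimes> a" using assms by (simp add: m_assoc)
  also have "\<dots> = d [^] k \<otimes> (x \<otimes> a)" using assms(1-3) Suc by (simp add: m_assoc)
  also have "\<dots> = d [^] Suc k \<otimes> x" using assms by (simp add: m_assoc)
  finally show ?case .
qed (use assms in simp)

section \<open>Lifting relations of the quotient to the extension\<close>

lemma (in crossed_hom) shift_relation:
  assumes s: "s \<in> carrier G" "[c s = 0] (mod Q)" and t: "t \<in> carrier G" "[c t = 1] (mod Q)" "b t = 0"
    and Q: "Q > 0"
  obtains L k where "[int L = l ^ b s] (mod Q)" "k \<in> K" "s \<otimes> t = (k \<otimes> t [^] L) \<otimes> s"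
proof -
  define L where "L = nat (l ^ b s mod Q)"
  have L: "[int L = l ^ b s] (mod Q)" unfolding L_def using Q by simp
  have "[c (s \<otimes> t) = c s + l ^ b s * c t] (mod Q)" using c_mult s t by blast
  also have "[c s + l ^ b s * c t = 0 + l ^ b s * 1] (mod Q)"
    using s t by (intro cong_add cong_mult cong_refl)
  finally have 1: "[c (s \<otimes> t) = l ^ b s] (mod Q)" by simp
  have "[c (t [^] L \<otimes> s) = c (t [^] L) + c s] (mod Q)"
    using c_mult[of "t [^] L" s] s t c_pow(2)[OF t(1,3)] by simp
  also have "[c (t [^] L) + c s = int L * c t + 0] (mod Q)"
    using c_pow(1)[OF t(1,3)] s by (intro cong_add)
  also have "[int L * c t + 0 = l ^ b s * 1 + 0] (mod Q)"
    using t L by (intro cong_add cong_mult cong_refl)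
  finally have "[c (t [^] L \<otimes> s) = l ^ b s] (mod Q)" by simp
  \<comment> \<open>The relation holds exactly in the semidirect product, since both sides have
    column \<open>l ^ b s\<close> and layer \<open>b s\<close>; in the extension it therefore holds
    up to a factor in \<open>K\<close>.\<close>
  with 1 have cc: "[c (s \<otimes> t) = c (t [^] L \<otimes> s)] (mod Q)"
    using cong_sym cong_trans by blast
  have bb: "b (s \<otimes> t) = b (t [^] L \<otimes> s)"
    using b_mult[of s t] b_mult[of "t [^] L" s] s t c_pow(2)[OF t(1,3)] by (simp add: add.commute)
  obtain k where "k \<in> K" "s \<otimes> t = k \<otimes> (t [^] L \<otimes> s)"
    using K_coset[of "s \<otimes> t" "t [^] L \<otimes> s"] s t cc bb by auto
  then show thesis using that[OF L] s t K_carrier by (simp add: m_assoc)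
qed

lemma (in crossed_hom) pow_translation_in_K:
  assumes t: "t \<in> carrier G" "b t = 0" and Q: "Q = int q"
  shows "t [^] q \<in> K"
proof -
  have "[int q * c t = 0] (mod Q)" by (simp add: Q cong_def)
  with c_pow[OF t, of q] t(1) show ?thesis
    unfolding K_def using cong_trans by blast
qed

text \<open>The three generators are some \<open>z\<close> of order \<open>p\<close> in
  \<open>K\<close>, a power of \<open>t\<close> and a power of \<open>s\<close>. The power of
  \<open>t\<close> has exponent \<open>p\<close> without lying in \<open>K\<close> only because
  \<open>t\<close> has no power generating \<open>K\<close>; this is what \<open>lN\<close>
  enforces.\<close>

lemma (in crossed_hom) elementary_abelian_rank_three:
  fixes p m n e :: nat
  assumes p: "Factorial_Ring.prime p" and m: "m \<ge> 3" and n: "n \<ge> 1"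
    and Q: "Q = int p ^ (m - 1)" and N: "N = p ^ n"
    and l1: "[l = 1] (mod int p)" and lN: "\<not> [l ^ (p ^ n) = 1] (mod int p ^ m)"
    and order: "order G = p ^ e" and K: "card K = p"
    and s: "s \<in> carrier G" "[c s = 0] (mod Q)" "b s = 1" "s [^] (p ^ n) = \<one>"
    and t: "t \<in> carrier G" "[c t = 1] (mod Q)" "b t = 0"
  obtains E where "E \<subseteq> carrier G" "card E = p * p * p"
    "\<And>x y. x \<in> E \<Longrightarrow> y \<in> E \<Longrightarrow> x \<otimes> y = y \<otimes> x" "\<And>x. x \<in> E \<Longrightarrow> x [^] p = \<one>"
proof -
  have p1: "p > 1" by (rule prime_gt_1_nat[OF p])
  have Q0: "Q > 0" unfolding Q using p1 by simp
  have primeK: "Factorial_Ring.prime (card K)" using p K by simp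
  define T where "T = p ^ (m - 1)"
  have QT: "Q = int T" by (simp add: Q T_def)
  have Tp: "T * p = p ^ m" using m by (cases m) (simp_all add: T_def mult.commute)
  have tK: "t [^] T \<in> K" by (rule pow_translation_in_K[OF t(1,3) QT])
  have tT: "t [^] T = \<one>"
  proof (rule ccontr)
    assume nt: "t [^] T \<noteq> \<one>"
    obtain L k where L: "[int L = l ^ b s] (mod Q)" and k: "k \<in> K"
      and eq: "s \<otimes> t = (k \<otimes> t [^] L) \<otimes> s"
      using shift_relation[OF s(1,2) t Q0] by blast
    \<comment> \<open>Under the contrary assumption \<open>t [^] T\<close> generates
      \<open>K\<close>, so the error factor \<open>k\<close> is itself a power of \<open>t\<close>
      and \<open>s\<close> normalises the group generated by \<open>t\<close>.\<close>
    obtain i where "k = (t [^] T) [^] (i::nat)"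
      using prime_K_generated(3)[OF primeK tK nt] k by blast
    then have eq': "s \<otimes> t = t [^] (T * i + L) \<otimes> s"
      using eq t(1) by (simp add: nat_pow_pow nat_pow_mult)
    have "t = t [^] ((T * i + L) ^ (p ^ n))"
      using conj_pow[OF s(1) t(1) eq', of "p ^ n"] s(4) t(1) by simp
    then have "[(T * i + L) ^ (p ^ n) = 1] (mod ord t)"
      using pow_eq_iff_cong[OF t(1), of "(T * i + L) ^ (p ^ n)" 1] t(1) by simp
    moreover have "ord t = p ^ m"
    proof -
      have "t [^] (p ^ m) = (t [^] T) [^] p"
        using t(1) Tp by (simp add: nat_pow_pow)
      also have "\<dots> = \<one>" using prime_K_generated(2)[OF primeK tK nt] K by simp
      finally have "ord t dvd p ^ m" using pow_eq_id[OF t(1)] by blast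
      then obtain j where j: "j \<le> m" "ord t = p ^ j" using p by (auto simp: divides_primepow_nat)
      have "\<not> ord t dvd T" using nt pow_eq_id[OF t(1)] by blast
      then have "\<not> j \<le> m - 1" unfolding j(2) T_def using le_imp_power_dvd by blast
      then have "j = m" using j(1) by simp
      with j(2) show ?thesis by simp
    qed
    ultimately have "[int ((T * i + L) ^ (p ^ n)) = int 1] (mod int (p ^ m))"
      by (simp only: cong_int_iff)
    then have 1: "[int (T * i + L) ^ (p ^ n) = 1] (mod int p ^ m)" by simp
    \<comment> \<open>The conjugation exponent is known only modulo \<open>p ^ (m - 1)\<close>, but
      raising to the power \<open>p ^ n\<close> with \<open>n > 0\<close> gains the missing factor
      \<open>p\<close> and contradicts \<open>lN\<close>.\<close>
    have "[int (T * i + L) = l] (mod int p ^ (m - 1))"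
    proof -
      have "[int (T * i) + int L = 0 + l] (mod Q)"
        using L s(3) by (intro cong_add) (simp_all add: QT cong_def)
      then show ?thesis by (simp add: Q)
    qed
    from power_cong_prime_power[OF this, of n] have "[int (T * i + L) ^ (p ^ n) = l ^ (p ^ n)] (mod int p ^ m)"
      using m n by simp
    with 1 lN show False using cong_sym cong_trans by blast
  qed
  have "\<exists>z\<in>K. z \<noteq> \<one>"
  proof (rule ccontr)
    assume "\<not> (\<exists>z\<in>K. z \<noteq> \<one>)"
    then have "K \<subseteq> {\<one>}" by blast
    then have "card K \<le> card {\<one>}" by (intro card_mono) auto
    with K p1 show False by simp
  qed
  then obtain z where z: "z \<in> K" "z \<noteq> \<one>" by blast
  have zG: "z \<in> carrier G" using z K_carrier by blast
  have central: "x \<otimes> k = k \<otimes> x" if "x \<in> carrier G" "k \<in> K" for x k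
    using prime_K_central[OF primeK, of e] order K that by simp
  have exp_K: "k [^] p = \<one>" if "k \<in> K" for k
    using prime_K_generated(2)[OF primeK that] K by (cases "k = \<one>") auto
  \<comment> \<open>The exponents are one factor \<open>p\<close> short of those that kill
    \<open>s\<close> and \<open>t\<close>, so \<open>s'\<close> and \<open>y\<close> are
    \<open>p\<close>-th roots of 1.\<close>
  define s' where "s' = s [^] (p ^ (n - 1))"
  define y where "y = t [^] (p ^ (m - 2))"
  have s'G: "s' \<in> carrier G" and yG: "y \<in> carrier G" using s t by (simp_all add: s'_def y_def)
  have pn: "p ^ (n - 1) * p = p ^ n"  using n by (cases n) (simp_all add: mult.commute)
  have pm: "p ^ (m - 2) * p = T"
  proof -
    have "m - 1 = Suc (m - 2)" using m by simp
    then show ?thesis by (simp add: T_def mult.commute)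
  qed
  have s'p: "s' [^] p = \<one>" unfolding s'_def nat_pow_pow[OF s(1)] pn by (rule s(4))
  have yp: "y [^] p = \<one>" unfolding y_def nat_pow_pow[OF t(1)] pm by (rule tT)
  have pn_less: "p ^ (n - 1) < p ^ n" using p1 n by simp
  have bs': "b s' = p ^ (n - 1)"
    using b_pow[OF s(1), of "p ^ (n - 1)"] s(3) pn_less by (simp add: s'_def N)
  have cs': "[c s' = 0] (mod Q)" unfolding s'_def by (rule c_pow_zero[OF s(1,2)])
  \<comment> \<open>Conjugation by \<open>s'\<close> takes \<open>t\<close> to
    \<open>k \<otimes> t [^] L\<close>. On the power with exponent \<open>j = p ^ (m - 2)\<close>
    the central factor dies because \<open>m \<ge> 3\<close> gives \<open>p dvd j\<close>, and
    \<open>L = 1\<close> modulo \<open>p\<close> makes \<open>t [^] (L * j)\<close> equal to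
    \<open>t [^] j\<close>.\<close>
  have sy: "s' \<otimes> y = y \<otimes> s'"
  proof -
    obtain L k where L: "[int L = l ^ b s'] (mod Q)" and k: "k \<in> K"
      and eq: "s' \<otimes> t = (k \<otimes> t [^] L) \<otimes> s'"
      using shift_relation[OF s'G cs' t Q0] by blast
    have kG: "k \<in> carrier G" using k K_carrier by blast
    define j where "j = p ^ (m - 2)"
    have "p dvd j" unfolding j_def using m by (simp add: dvd_power)
    then obtain j' where j': "j = p * j'" ..
    have "s' \<otimes> y = (k \<otimes> t [^] L) [^] j \<otimes> s'"
      unfolding y_def j_def using s'G t(1) kG eq by (intro commute_shift_pow) auto
    also have "(k \<otimes> t [^] L) [^] j = k [^] j \<otimes> (t [^] L) [^] j"
      using kG t(1) central[of "t [^] L" k] k by (intro pow_mult_distrib) auto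
    also have "k [^] j = \<one>"
      using kG exp_K[OF k] by (simp add: j' nat_pow_pow[symmetric])
    also have "(t [^] L) [^] j = t [^] j"
    proof -
      have "int p dvd Q" unfolding Q using m by (simp add: dvd_power)
      then have "[int L = l ^ b s'] (mod int p)" by (rule cong_dvd_modulus[OF L])
      moreover have "[l ^ b s' = 1 ^ b s'] (mod int p)" by (rule cong_pow[OF l1])
      ultimately have "[int L = int 1] (mod int p)" using cong_trans by fastforce
      then have "[L = 1] (mod p)" by (simp only: cong_int_iff)
      then have "[j * L = j * 1] (mod j * p)"
        unfolding j_def using p1 by (simp add: cong_def mod_mult_mult1)
      moreover have "ord t dvd j * p"
        using pow_eq_id[OF t(1)] tT by (simp add: j_def pm)
      ultimately have "[L * j = j] (mod ord t)"
        using cong_dvd_modulus_nat by (simp add: mult.commute)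
      then show ?thesis using t(1) by (simp add: nat_pow_pow pow_eq_iff_cong)
    qed
    finally show ?thesis using t(1) by (simp add: y_def j_def)
  qed
  define w where "w = (\<lambda>(i::nat, j::nat, h::nat). z [^] i \<otimes> y [^] j \<otimes> s' [^] h)"
  define D where "D = {..<p} \<times> {..<p} \<times> {..<p}"
  have zc: "z \<otimes> x = x \<otimes> z" if "x \<in> carrier G" for x using central[OF that z(1)] by simp
  note w = commuting_triple_products[OF zG yG s'G zc[OF yG] zc[OF s'G] sy[symmetric] exp_K[OF z(1)] yp s'p,
      folded w_def]
  have by0: "b y = 0" unfolding y_def by (rule c_pow(2)[OF t(1,3)])
  have cy: "[c y = int (p ^ (m - 2))] (mod Q)"
  proof -
    have "[int (p ^ (m - 2)) * c t = int (p ^ (m - 2)) * 1] (mod Q)"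
      by (intro cong_mult cong_refl t(2))
    then show ?thesis using c_pow(1)[OF t(1,3), of "p ^ (m - 2)"] cong_trans unfolding y_def by fastforce
  qed
  have bw: "b (w (i, j, h)) = h * p ^ (n - 1) mod p ^ n"
    and cw: "[c (w (i, j, h)) = int (j * p ^ (m - 2))] (mod Q)" for i j h
  proof -
    have zi: "b (z [^] i) = 0" "[c (z [^] i) = 0] (mod Q)"
      using c_pow(2)[OF zG K_b[OF z(1)]] c_pow_zero[OF zG K_c[OF z(1)]] by blast+
    have yj: "b (y [^] j) = 0" by (rule c_pow(2)[OF yG by0])
    have zy: "b (z [^] i \<otimes> y [^] j) = 0"
      using b_mult[of "z [^] i" "y [^] j"] zG yG zi yj by simp
    then show "b (w (i, j, h)) = h * p ^ (n - 1) mod p ^ n"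
      using b_mult[of "z [^] i \<otimes> y [^] j" "s' [^] h"] zG yG s'G b_pow[OF s'G, of h] bs'
      by (simp add: w_def N)
    have "[c (w (i, j, h)) = c (z [^] i \<otimes> y [^] j) + c (s' [^] h)] (mod Q)"
      using c_mult[of "z [^] i \<otimes> y [^] j" "s' [^] h"] zG yG s'G zy by (simp add: w_def)
    also have "[c (z [^] i \<otimes> y [^] j) + c (s' [^] h) = (c (z [^] i) + c (y [^] j)) + 0] (mod Q)"
      using c_mult[of "z [^] i" "y [^] j"] zG yG zi c_pow_zero[OF s'G cs'] by (intro cong_add) simp_all
    also have "[(c (z [^] i) + c (y [^] j)) + 0 = (0 + int j * c y) + 0] (mod Q)"
      using zi c_pow(1)[OF yG by0] by (intro cong_add cong_refl)
    also have "[(0 + int j * c y) + 0 = (0 + int j * int (p ^ (m - 2))) + 0] (mod Q)"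
      by (intro cong_add cong_mult cong_refl cy)
    finally show "[c (w (i, j, h)) = int (j * p ^ (m - 2))] (mod Q)" by simp
  qed
  \<comment> \<open>The layer recovers \<open>h\<close>, the column modulo \<open>Q\<close> recovers
    \<open>j\<close>, and after cancelling these factors the order of \<open>z\<close> recovers
    \<open>i\<close>.\<close>
  have "inj_on w D"
  proof (rule inj_onI)
    fix u v assume "u \<in> D" "v \<in> D" and eq: "w u = w v"
    then obtain i j h i' j' h' where u: "u = (i, j, h)" "i < p" "j < p" "h < p"
      and v: "v = (i', j', h')" "i' < p" "j' < p" "h' < p"
      unfolding D_def by auto
    have less: "h * p ^ (n - 1) < p ^ n" "j * p ^ (m - 2) < T" if "h < p" "j < p" for h j
      using that p1 unfolding pn[symmetric] pm[symmetric] by simp_all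
    have "h * p ^ (n - 1) = h' * p ^ (n - 1)"
      using bw[of i j h] bw[of i' j' h'] eq u v less[of h j] less[of h' j'] by simp
    then have h: "h = h'" using p1 by simp
    have "[int (j * p ^ (m - 2)) = int (j' * p ^ (m - 2))] (mod int T)"
      using cw[of i j h] cw[of i' j' h'] eq u v QT cong_sym cong_trans by metis
    then have "[j * p ^ (m - 2) = j' * p ^ (m - 2)] (mod T)" by (simp only: cong_int_iff)
    then have "j * p ^ (m - 2) = j' * p ^ (m - 2)"
      using less[of h j] less[of h' j'] u v cong_less_modulus_unique_nat by blast
    then have j: "j = j'" using p1 by simp
    have "z [^] i = z [^] i'"
      using eq zG yG s'G unfolding u v w_def h j by simp
    then have "i = i'"
      using pow_eq_less_ord[OF zG] prime_K_generated(1)[OF primeK z] K u v by simp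
    with h j show "u = v" by (simp add: u v)
  qed
  then have "card (w ` D) = p * p * p" by (simp add: card_image D_def)
  moreover have "w ` D \<subseteq> carrier G" using w(1) by blast
  ultimately show thesis using that[of "w ` D"] w(2,3) by blast
qed

lemma (in crossed_hom) not_metacyclic:
  fixes p m n e :: nat
  assumes p: "Factorial_Ring.prime p" and m: "m \<ge> 3" and n: "n \<ge> 1"
    and Q: "Q = int p ^ (m - 1)" and N: "N = p ^ n"
    and l1: "[l = 1] (mod int p)" and lN: "\<not> [l ^ (p ^ n) = 1] (mod int p ^ m)"
    and order: "order G = p ^ e" and K: "card K = p"
    and s: "s \<in> carrier G" "[c s = 0] (mod Q)" "b s = 1" "s [^] (p ^ n) = \<one>"
    and t: "t \<in> carrier G" "[c t = 1] (mod Q)" "b t = 0"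
  shows "\<not> metacyclic_group G"
proof
  assume meta: "metacyclic_group G"
  have p1: "p > 1" by (rule prime_gt_1_nat[OF p])
  obtain E where E: "E \<subseteq> carrier G" "card E = p * p * p"
    "\<And>x y. x \<in> E \<Longrightarrow> y \<in> E \<Longrightarrow> x \<otimes> y = y \<otimes> x" "\<And>x. x \<in> E \<Longrightarrow> x [^] p = \<one>"
    using elementary_abelian_rank_three[OF assms] by blast
  have "finite (carrier G)"
    using order p1 unfolding order_def by (metis card.infinite power_eq_0_iff not_less_zero)
  from metacyclic_group_card_commuting_roots_le[OF meta this _ E(1,3,4)]
  have "p * p * p \<le> p * p" using p1 E(2) by simp
  with p1 show False by simp
qed

section \<open>The multilayer generalized Petersen graph\<close>

locale petersen =
  fixes p m n lam :: nat
  assumes prime_p: "Factorial_Ring.prime p" and odd_p: "odd p"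
    and m_ge: "m \<ge> n + 2" and n_ge: "n \<ge> 1"
    and ord_lam: "ord (p ^ m) lam = p ^ (n + 1)"
begin

text \<open>Quantities concerning columns are integers, since columns are subtracted;
  \<open>N\<close> is a natural number because layers serve as exponents of
  \<open>l\<close>.\<close>

definition l :: int where "l = int lam"
definition Q :: int where "Q = int p ^ (m - 1)"
definition M :: int where "M = int p ^ m"
definition N :: nat where "N = p ^ n"
definition V :: "(int \<times> nat) set" where "V = {0..<M} \<times> {0..<N}"
abbreviation \<Gamma> :: "(int \<times> nat) ugraph" where "\<Gamma> \<equiv> MP (p ^ m) (p ^ n) (p ^ (m - 1)) lam"

section \<open>Powers of \<open>l\<close> modulo \<open>p\<close>, \<open>Q\<close> and
  \<open>M\<close>\<close>

lemma p_gt_1: "p > 1" by (rule prime_gt_1_nat[OF prime_p])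

lemma p_ge_3: "p \<ge> 3"
  using p_gt_1 odd_p by (cases "p = 2") auto

lemma M_eq: "M = int p * Q"
  unfolding M_def Q_def using m_ge by (cases m) auto

lemma Q_pos: "Q > 0" and M_pos: "M > 0"
  unfolding Q_def M_def using p_gt_1 by auto

lemma Q_dvd_M: "Q dvd M"
  by (simp add: M_eq)

lemma p_dvd_Q: "int p dvd Q"
  unfolding Q_def using m_ge n_ge by (simp add: dvd_power)

lemma N_ge_3: "N \<ge> 3"
proof -
  have "p ^ 1 \<le> p ^ n" using n_ge p_gt_1 by (intro power_increasing) auto
  then show ?thesis using p_ge_3 unfolding N_def by simp
qed

lemma cong_M_imp_cong_Q: "[a = b] (mod M) \<Longrightarrow> [a = b] (mod Q)"
  using Q_dvd_M by (rule cong_dvd_modulus[rotated])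

lemma cong_Q_imp_cong_p: "[a = b] (mod Q) \<Longrightarrow> [a = b] (mod int p)"
  using p_dvd_Q by (rule cong_dvd_modulus[rotated])

lemma l_pow_cong_1_mod_M_iff: "[l ^ k = 1] (mod M) \<longleftrightarrow> p ^ (n + 1) dvd k"
proof -
  have "[l ^ k = 1] (mod M) \<longleftrightarrow> [int (lam ^ k) = int 1] (mod int (p ^ m))"
    by (simp add: l_def M_def)
  also have "\<dots> \<longleftrightarrow> p ^ (n + 1) dvd k"
    using ord_divides ord_lam by (simp only: cong_int_iff)
  finally show ?thesis .
qed

text \<open>The order of \<open>l\<close> modulo \<open>M\<close> is a power of \<open>p\<close>,
  and raising to such a power is the identity modulo \<open>p\<close>.\<close>

lemma l_cong_1: "[l = 1] (mod int p)"
proof -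
  have "[l ^ (p ^ (n + 1)) = 1] (mod int p)"
    by (intro cong_Q_imp_cong_p cong_M_imp_cong_Q) (simp add: l_pow_cong_1_mod_M_iff)
  moreover have "[int (lam ^ (p ^ (n + 1))) = int lam] (mod int p)"
    using fermat_prime_power[OF prime_p] by (simp only: cong_int_iff)
  ultimately show ?thesis
    unfolding l_def using cong_sym cong_trans by (metis of_nat_power)
qed

lemma l_pow_cong_1: "[l ^ k = 1] (mod int p)"
  using cong_pow[OF l_cong_1, of k] by simp

text \<open>The \<open>p\<close>-th power of \<open>l ^ N\<close> is 1 modulo
  \<open>M = p * Q\<close>; extracting the root costs one factor \<open>p\<close>.\<close>

lemma l_pow_N_cong_Q: "[l ^ N = 1] (mod Q)"
  unfolding Q_def
proof (rule cong_one_prime_power_descend[OF prime_p odd_p l_pow_cong_1])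
  have "[l ^ (p ^ n * p) = 1] (mod M)"
    using l_pow_cong_1_mod_M_iff by (simp add: mult.commute)
  then show "[(l ^ N) ^ p = 1] (mod int p ^ Suc (m - 1))"
    using m_ge by (simp add: N_def power_mult[symmetric] M_def)
qed

lemma l_pow_N_not_cong_M: "\<not> [l ^ (p ^ n) = 1] (mod int p ^ m)"
proof -
  have "\<not> p ^ (n + 1) dvd p ^ n" using p_gt_1 by (simp add: dvd_power_iff_le)
  then show ?thesis using l_pow_cong_1_mod_M_iff unfolding M_def by blast
qed

text \<open>This makes the step \<open>l ^ i\<close> of a layer compatible with reading layers
  cyclically. The congruence is modulo \<open>Q\<close>; modulo \<open>M\<close> it fails already
  for \<open>i = N\<close>.\<close>

lemma l_pow_mod_N: "[l ^ (i mod N) = l ^ i] (mod Q)"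
proof -
  have "[(l ^ N) ^ (i div N) * l ^ (i mod N) = 1 ^ (i div N) * l ^ (i mod N)] (mod Q)"
    by (intro cong_mult cong_refl cong_pow l_pow_N_cong_Q)
  moreover have "(l ^ N) ^ (i div N) * l ^ (i mod N) = l ^ i"
    by (simp add: power_mult[symmetric] power_add[symmetric])
  ultimately show ?thesis by (simp add: cong_sym_eq)
qed

lemma coprime_2_Q: "coprime 2 Q"
  unfolding Q_def using odd_p by simp

lemma coprime_if_cong_1:
  assumes "[a = 1] (mod int p)"
  shows "coprime a Q" "coprime a M"
proof -
  have "coprime (int p) a"
    using assms by (metis cong_imp_coprime cong_sym coprime_1_left coprime_commute)
  then show "coprime a Q" "coprime a M"
    unfolding Q_def M_def by (simp_all add: coprime_commute)
qed

lemma p_not_dvd_2: "\<not> int p dvd 2"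
  using p_ge_3 by (auto dest!: zdvd_imp_le)

text \<open>Such an \<open>a\<close> is coprime to \<open>Q\<close>, and so are 2 and 4 because
  \<open>p\<close> is odd. With \<open>a\<close> a power of \<open>l\<close> this rules out
  coincidences after a few steps inside a layer.\<close>

lemma not_cong_Q_if_cong_1:
  assumes "[a = 1] (mod int p)" shows "\<not> Q dvd a" "\<not> Q dvd 2 * a" "\<not> Q dvd 4 * a"
proof -
  have "\<not> Q dvd 1"
  proof
    assume "Q dvd 1"
    then have "int p dvd 1" using p_dvd_Q by (rule dvd_trans[rotated])
    then show False using p_gt_1 zdvd_imp_le[of "int p" 1] by simp
  qed
  moreover have c: "coprime Q a" "coprime Q 2" using coprime_if_cong_1[OF assms] coprime_2_Q
    by (simp_all add: coprime_commute)
  moreover have "coprime Q 4" using coprime_mult_right_iff[of Q 2 2] c by simp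
  ultimately show "\<not> Q dvd a" "\<not> Q dvd 2 * a" "\<not> Q dvd 4 * a"
    by (metis coprime_dvd_mult_left_iff coprime_dvd_mult_right_iff mult.right_neutral)+
qed

text \<open>In the first case \<open>l + 1\<close> is 2 modulo \<open>p\<close>, hence coprime to
  \<open>Q\<close>, which forces \<open>l = 1\<close> modulo \<open>Q\<close> and order at most
  \<open>p\<close> modulo \<open>M\<close>, against \<open>n \<ge> 1\<close>. The second case would
  give \<open>-1 = 1\<close> modulo \<open>p\<close>.\<close>

lemma l_squared: "\<not> [l\<^sup>2 = 1] (mod Q)" "\<not> [l\<^sup>2 = - 1] (mod Q)"
proof
  assume "[l\<^sup>2 = 1] (mod Q)"
  then have "Q dvd (l - 1) * (l + 1)"
    by (simp add: cong_iff_dvd_diff power2_eq_square algebra_simps)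
  moreover have "coprime Q (l + 1)"
  proof -
    have "[l + 1 = 2] (mod int p)" using cong_add[OF l_cong_1 cong_refl[of 1]] by simp
    moreover have "coprime (int p) 2" using odd_p by simp
    ultimately have "coprime (int p) (l + 1)"
      by (metis cong_imp_coprime cong_sym coprime_commute)
    then show ?thesis unfolding Q_def by simp
  qed
  ultimately have "[l = 1] (mod Q)"
    by (simp add: cong_iff_dvd_diff coprime_dvd_mult_left_iff)
  then have "[l ^ (p ^ 1) = 1 ^ (p ^ 1)] (mod int p ^ Suc (m - 1))"
    unfolding Q_def by (rule power_cong_prime_power) (use m_ge n_ge in auto)
  then have "[l ^ p = 1] (mod M)" using m_ge by (simp add: M_def)
  then have "p ^ (n + 1) dvd p ^ 1" using l_pow_cong_1_mod_M_iff by simp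
  then have "n + 1 \<le> 1" using p_gt_1 by (simp only: dvd_power_iff_le)
  with n_ge show False by simp
next
  show "\<not> [l\<^sup>2 = - 1] (mod Q)"
  proof
    assume "[l\<^sup>2 = - 1] (mod Q)"
    then have "[- 1 = 1] (mod int p)"
      using l_pow_cong_1[of 2] cong_Q_imp_cong_p cong_sym cong_trans by blast
    then show False using p_not_dvd_2 by (simp add: cong_iff_dvd_diff)
  qed
qed

section \<open>Adjacency in arithmetic form\<close>

definition layer_adj :: "int \<times> nat \<Rightarrow> int \<times> nat \<Rightarrow> bool" where
  "layer_adj u v \<longleftrightarrow> snd u = snd v \<and>
     ([fst v = fst u + l ^ snd u] (mod Q) \<or> [fst v = fst u - l ^ snd u] (mod Q))"

definition cross_adj :: "int \<times> nat \<Rightarrow> int \<times> nat \<Rightarrow> bool" where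
  "cross_adj u v \<longleftrightarrow> fst u = fst v \<and> (snd v = Suc (snd u) mod N \<or> snd u = Suc (snd v) mod N)"

definition adj :: "int \<times> nat \<Rightarrow> int \<times> nat \<Rightarrow> bool" where
  "adj u v \<longleftrightarrow> layer_adj u v \<or> cross_adj u v"

lemma layer_adj_sym: "layer_adj u v \<longleftrightarrow> layer_adj v u"
  unfolding layer_adj_def cong_iff_dvd_diff
  by (auto simp: algebra_simps dvd_diff_commute)

lemma cross_adj_sym: "cross_adj u v \<longleftrightarrow> cross_adj v u"
  unfolding cross_adj_def by auto

lemma adj_sym: "adj u v \<longleftrightarrow> adj v u"
  unfolding adj_def using layer_adj_sym cross_adj_sym by blast

lemma mod_N_neq: "i < N \<Longrightarrow> Suc i mod N \<noteq> i"
  using N_ge_3 by (cases "Suc i = N") auto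

lemma adj_irrefl: "v \<in> V \<Longrightarrow> \<not> adj v v"
proof -
  assume v: "v \<in> V"
  have "\<not> layer_adj v v"
    using not_cong_Q_if_cong_1(1)[OF l_pow_cong_1[of "snd v"]]
    by (auto simp: layer_adj_def cong_iff_dvd_diff)
  moreover have "\<not> cross_adj v v"
    using v mod_N_neq[of "snd v"] by (auto simp: cross_adj_def V_def)
  ultimately show ?thesis by (simp add: adj_def)
qed

lemma verts_MP: "verts \<Gamma> = V"
  by (simp add: MP_def MP_verts_def V_def M_def N_def)

lemma finite_V: "finite V"
  by (simp add: V_def)

lemma card_V: "card V = p ^ (m + n)"
  by (simp add: V_def M_def N_def card_cartesian_product power_add nat_power_eq)

text \<open>There are exactly \<open>p\<close> values of \<open>k\<close>, so the summands
  \<open>k * Q\<close> run through all multiples of \<open>Q\<close> modulo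
  \<open>M = p * Q\<close>, and the edge condition becomes a congruence modulo
  \<open>Q\<close>.\<close>

lemma layer_step_iff:
  assumes "0 \<le> j'" "j' < M"
  shows "(\<exists>k\<in>{0..<p ^ m div p ^ (m - 1)}. j' = (j + int k * int (p ^ (m - 1)) + int lam ^ i) mod int (p ^ m))
      \<longleftrightarrow> [j' = j + l ^ i] (mod Q)" (is "?L = ?R")
    and "(\<exists>k\<in>{0..<p ^ m div p ^ (m - 1)}. j' = (j - int k * int (p ^ (m - 1)) - int lam ^ i) mod int (p ^ m))
      \<longleftrightarrow> [j' = j - l ^ i] (mod Q)" (is "?L' = ?R'")
proof -
  have pp: "p ^ m div p ^ (m - 1) = p"
  proof -
    have "m = Suc (m - 1)" using m_ge by simp
    then have "p ^ m = p * p ^ (m - 1)" by (metis power_Suc)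
    then show ?thesis using p_gt_1 by simp
  qed
  have Q': "int (p ^ (m - 1)) = Q" and M': "int (p ^ m) = M"
    by (simp_all add: Q_def M_def)
  have j': "j' mod M = j'" using assms by simp
  have main: "(\<exists>k\<in>{0..<p}. j' = (a + e * (int k * Q)) mod M) \<longleftrightarrow> [j' = a] (mod Q)"
    if e: "e = 1 \<or> e = - 1" for a e :: int
  proof
    assume "\<exists>k\<in>{0..<p}. j' = (a + e * (int k * Q)) mod M"
    then obtain k where "[j' = a + e * (int k * Q)] (mod M)" by (auto simp: cong_def)
    then have "[j' = a + e * (int k * Q)] (mod Q)" by (rule cong_M_imp_cong_Q)
    then show "[j' = a] (mod Q)"
      by (metis (no_types, lifting) cong_def mod_mult_self1 mult.assoc)
  next
    assume "[j' = a] (mod Q)"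
    then obtain d where d: "j' = a + Q * d" by (metis cong_iff_dvd_diff add.commute diff_add_cancel dvdE)
    \<comment> \<open>This solves \<open>e * k = d\<close> modulo \<open>p\<close>, since the sign
      \<open>e\<close> is its own inverse.\<close>
    define k where "k = nat ((e * d) mod int p)"
    have k: "int k = (e * d) mod int p" and kp: "k < p"
      using p_gt_1 by (simp_all add: k_def nat_less_iff)
    have ee: "e * e = 1" using e by auto
    have "int p dvd e * d - int k" by (simp add: k minus_mod_eq_mult_div)
    then have "int p dvd e * (e * d - int k)" by simp
    also have "e * (e * d - int k) = d - e * int k"
      by (metis ee mult.assoc mult_1 right_diff_distrib)
    finally have "M dvd (d - e * int k) * Q"
      unfolding M_eq by (rule mult_dvd_mono) simp
    then have "[j' = a + e * (int k * Q)] (mod M)"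
      by (simp add: cong_iff_dvd_diff d algebra_simps)
    then have "j' = (a + e * (int k * Q)) mod M" using j' by (simp add: cong_def)
    then show "\<exists>k\<in>{0..<p}. j' = (a + e * (int k * Q)) mod M" using kp by auto
  qed
  show "?L = ?R"
    using main[of 1 "j + l ^ i"] unfolding pp Q' M' l_def by (simp add: algebra_simps)
  show "?L' = ?R'"
    using main[of "-1" "j - l ^ i"] unfolding pp Q' M' l_def by (simp add: algebra_simps)
qed

lemma edges_MP: "edges \<Gamma> = {{u, v} | u v. u \<in> V \<and> v \<in> V \<and> adj u v}" (is "_ = ?E")
proof
  have mod_in: "0 \<le> x mod int (p ^ m)" "x mod int (p ^ m) < M" for x
    using M_pos by (simp_all add: M_def)
  show "edges \<Gamma> \<subseteq> ?E"
  proof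
    fix e assume "e \<in> edges \<Gamma>"
    then obtain i where i: "i < N" and e: "e \<in> MP_layer_edges (p ^ m) (p ^ (m - 1)) lam i
        \<or> e \<in> MP_cross_edges (p ^ m) (p ^ n) i"
      by (auto simp: MP_def N_def)
    from e show "e \<in> ?E"
    proof
      assume "e \<in> MP_layer_edges (p ^ m) (p ^ (m - 1)) lam i"
      then obtain k j where k: "k \<in> {0..<p ^ m div p ^ (m - 1)}" and j: "j \<in> {0..<int (p ^ m)}"
        and e: "e = {(j, i), ((j + int k * int (p ^ (m - 1)) + int lam ^ i) mod int (p ^ m), i)}
          \<or> e = {(j, i), ((j - int k * int (p ^ (m - 1)) - int lam ^ i) mod int (p ^ m), i)}"
        unfolding MP_layer_edges_def by blast
      from e obtain j' where e: "e = {(j, i), (j', i)}" and j': "0 \<le> j'" "j' < M"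
        and c: "[j' = j + l ^ i] (mod Q) \<or> [j' = j - l ^ i] (mod Q)"
      proof (elim disjE)
        let ?a = "(j + int k * int (p ^ (m - 1)) + int lam ^ i) mod int (p ^ m)"
        assume "e = {(j, i), (?a, i)}"
        moreover have "[?a = j + l ^ i] (mod Q)"
          using layer_step_iff(1)[OF mod_in] k by blast
        ultimately show thesis using that mod_in by blast
      next
        let ?a = "(j - int k * int (p ^ (m - 1)) - int lam ^ i) mod int (p ^ m)"
        assume "e = {(j, i), (?a, i)}"
        moreover have "[?a = j - l ^ i] (mod Q)"
          using layer_step_iff(2)[OF mod_in] k by blast
        ultimately show thesis using that mod_in by blast
      qed
      have "(j, i) \<in> V" "(j', i) \<in> V" using i j j' by (auto simp: V_def M_def)
      moreover have "adj (j, i) (j', i)" using c by (simp add: adj_def layer_adj_def)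
      ultimately show ?thesis using e by blast
    next
      assume "e \<in> MP_cross_edges (p ^ m) (p ^ n) i"
      then obtain j where j: "j \<in> {0..<int (p ^ m)}" and e: "e = {(j, i), (j, (i + 1) mod N)}"
        by (auto simp: MP_cross_edges_def N_def)
      have "(j, i) \<in> V" "(j, (i + 1) mod N) \<in> V" using i j N_ge_3 by (auto simp: V_def M_def)
      moreover have "adj (j, i) (j, (i + 1) mod N)" by (simp add: adj_def cross_adj_def)
      ultimately show ?thesis using e by blast
    qed
  qed
next
  show "?E \<subseteq> edges \<Gamma>"
  proof
    fix e assume "e \<in> ?E"
    then obtain j i j' i' where e: "e = {(j, i), (j', i')}" and u: "(j, i) \<in> V" and v: "(j', i') \<in> V"
      and a: "adj (j, i) (j', i')" by auto
    have jM: "j \<in> {0..<int (p ^ m)}" "j' \<in> {0..<int (p ^ m)}" and iN: "i < p ^ n" "i' < p ^ n"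
      and j': "0 \<le> j'" "j' < M"
      using u v by (auto simp: V_def M_def N_def)
    \<comment> \<open>A cross edge is listed under the cyclically earlier of its two layers, which
      may be either end.\<close>
    from a have "e \<in> MP_layer_edges (p ^ m) (p ^ (m - 1)) lam i \<or>
        e \<in> MP_cross_edges (p ^ m) (p ^ n) i \<or> e \<in> MP_cross_edges (p ^ m) (p ^ n) i'"
      unfolding adj_def
    proof
      assume "layer_adj (j, i) (j', i')"
      then have i': "i' = i" and c: "[j' = j + l ^ i] (mod Q) \<or> [j' = j - l ^ i] (mod Q)"
        by (auto simp: layer_adj_def)
      then show ?thesis
        using layer_step_iff[OF j', of j i] jM(1) unfolding e i' MP_layer_edges_def by blast
    next
      assume "cross_adj (j, i) (j', i')"
      then show ?thesis
        using jM unfolding e cross_adj_def MP_cross_edges_def N_def by (auto simp: insert_commute)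
    qed
    then show "e \<in> edges \<Gamma>" using iN by (auto simp: MP_def)
  qed
qed

lemma edge_iff_adj: "u \<in> V \<Longrightarrow> v \<in> V \<Longrightarrow> {u, v} \<in> edges \<Gamma> \<longleftrightarrow> adj u v"
  unfolding edges_MP mem_Collect_eq doubleton_eq_iff using adj_sym[of u v] by blast

lemma simple_graph_MP: "simple_graph \<Gamma>"
  unfolding simple_graph_def verts_MP edges_MP using finite_V adj_irrefl by blast

end

section \<open>A transitive metacyclic group of automorphisms\<close>

lemma add_pred_mult: "q > 0 \<Longrightarrow> b + (q - 1) * b = q * (b::nat)"
  by (cases q) auto

lemma (in group) cyclic_groupI:
  assumes "x \<in> carrier G" "\<And>y. y \<in> carrier G \<Longrightarrow> \<exists>k::nat. y = x [^] k"
  shows "cyclic_group G"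
proof -
  have "carrier G = range (\<lambda>k::int. x [^] k)"
  proof
    show "carrier G \<subseteq> range (\<lambda>k::int. x [^] k)"
      using assms(2) by (metis int_pow_int rangeI subsetI)
  qed (use assms(1) in auto)
  with assms(1) show ?thesis using cyclic_group by blast
qed

section \<open>Graph isomorphisms and automorphism groups\<close>

lemma graph_isomorphism_compose:
  assumes "graph_isomorphism \<Gamma> \<Delta> f" "graph_isomorphism \<Delta> \<Theta> g"
  shows "graph_isomorphism \<Gamma> \<Theta> (g \<circ> f)"
proof -
  have "f u \<in> verts \<Delta>" if "u \<in> verts \<Gamma>" for u
    using assms that unfolding graph_isomorphism_def by (meson bij_betwE)
  then show ?thesis
    using assms unfolding graph_isomorphism_def by (auto intro: bij_betw_trans)
qed

lemma graph_isomorphism_inv_into: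
  assumes "graph_isomorphism \<Gamma> \<Delta> f"
  shows "graph_isomorphism \<Delta> \<Gamma> (inv_into (verts \<Gamma>) f)"
proof -
  have bij: "bij_betw f (verts \<Gamma>) (verts \<Delta>)" using assms by (simp add: graph_isomorphism_def)
  show ?thesis
    unfolding graph_isomorphism_def
  proof (intro conjI ballI)
    show "bij_betw (inv_into (verts \<Gamma>) f) (verts \<Delta>) (verts \<Gamma>)" by (rule bij_betw_inv_into[OF bij])
    fix u v assume uv: "u \<in> verts \<Delta>" "v \<in> verts \<Delta>"
    let ?u = "inv_into (verts \<Gamma>) f u" and ?v = "inv_into (verts \<Gamma>) f v"
    have "?u \<in> verts \<Gamma>" "?v \<in> verts \<Gamma>" "f ?u = u" "f ?v = v"
      using uv bij by (auto simp: bij_betw_def inv_into_into f_inv_into_f)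
    then show "({u, v} \<in> edges \<Delta>) = ({?u, ?v} \<in> edges \<Gamma>)"
      using assms unfolding graph_isomorphism_def by metis
  qed
qed

lemma graph_isomorphism_cong:
  assumes "\<And>v. v \<in> verts \<Gamma> \<Longrightarrow> f v = g v"
  shows "graph_isomorphism \<Gamma> \<Delta> f \<longleftrightarrow> graph_isomorphism \<Gamma> \<Delta> g"
  unfolding graph_isomorphism_def using assms bij_betw_cong[of "verts \<Gamma>" f g] by auto

lemma aut_group_subgroup: "subgroup (carrier (aut_group \<Gamma>)) (BijGroup (verts \<Gamma>))"
proof -
  interpret B: group "BijGroup (verts \<Gamma>)" by (rule group_BijGroup)
  have c: "carrier (BijGroup (verts \<Gamma>)) = Bij (verts \<Gamma>)" by (simp add: BijGroup_def)
  have A: "carrier (aut_group \<Gamma>) = {f \<in> Bij (verts \<Gamma>). graph_isomorphism \<Gamma> \<Gamma> f}"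
    by (simp add: aut_group_def)
  show ?thesis
  proof (rule B.subgroupI)
    show "carrier (aut_group \<Gamma>) \<subseteq> carrier (BijGroup (verts \<Gamma>))" by (auto simp: A c)
    have "(\<lambda>x\<in>verts \<Gamma>. x) \<in> carrier (aut_group \<Gamma>)"
      unfolding A by (auto simp: id_Bij graph_isomorphism_def bij_betw_def inj_on_def)
    then show "carrier (aut_group \<Gamma>) \<noteq> {}" by blast
  next
    fix f assume f: "f \<in> carrier (aut_group \<Gamma>)"
    then have fB: "f \<in> Bij (verts \<Gamma>)" and fi: "graph_isomorphism \<Gamma> \<Gamma> f" by (simp_all add: A)
    have inv: "inv\<^bsub>BijGroup (verts \<Gamma>)\<^esub> f = restrict (inv_into (verts \<Gamma>) f) (verts \<Gamma>)"
      by (rule inv_BijGroup[OF fB])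
    have "graph_isomorphism \<Gamma> \<Gamma> (inv\<^bsub>BijGroup (verts \<Gamma>)\<^esub> f)"
      unfolding inv using graph_isomorphism_inv_into[OF fi]
      by (subst graph_isomorphism_cong[where g = "inv_into (verts \<Gamma>) f"]) auto
    then show "inv\<^bsub>BijGroup (verts \<Gamma>)\<^esub> f \<in> carrier (aut_group \<Gamma>)"
      using restrict_inv_into_Bij[OF fB] inv by (simp add: A)
  next
    fix f g assume "f \<in> carrier (aut_group \<Gamma>)" "g \<in> carrier (aut_group \<Gamma>)"
    then have fg: "f \<in> Bij (verts \<Gamma>)" "g \<in> Bij (verts \<Gamma>)"
      and i: "graph_isomorphism \<Gamma> \<Gamma> f" "graph_isomorphism \<Gamma> \<Gamma> g" by (simp_all add: A)
    have "graph_isomorphism \<Gamma> \<Gamma> (compose (verts \<Gamma>) f g)"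
      using graph_isomorphism_compose[OF i(2,1)]
      by (subst graph_isomorphism_cong[where g = "f \<circ> g"]) (auto simp: compose_eq)
    then show "f \<otimes>\<^bsub>BijGroup (verts \<Gamma>)\<^esub> g \<in> carrier (aut_group \<Gamma>)"
      using fg compose_Bij by (auto simp: A BijGroup_def)
  qed
qed

text \<open>\<open>aut_group\<close> and the full permutation group differ only in their carriers,
  so the conditions on \<open>R\<close> can be checked in \<open>BijGroup\<close>.\<close>

lemma weak_metacirculantI:
  fixes \<Gamma> :: "'v ugraph"
  defines "B \<equiv> BijGroup (verts \<Gamma>)"
  assumes simple: "simple_graph \<Gamma>" and R: "subgroup R B" and aut: "\<And>f. f \<in> R \<Longrightarrow> graph_isomorphism \<Gamma> \<Gamma> f"
    and meta: "metacyclic_group (B\<lparr>carrier := R\<rparr>)"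
    and trans: "\<And>u v. u \<in> verts \<Gamma> \<Longrightarrow> v \<in> verts \<Gamma> \<Longrightarrow> \<exists>f\<in>R. f u = v"
  shows "weak_metacirculant \<Gamma>"
proof -
  interpret B: group B unfolding B_def by (rule group_BijGroup)
  have AB: "(aut_group \<Gamma>)\<lparr>carrier := Y\<rparr> = B\<lparr>carrier := Y\<rparr>" for Y
    by (simp add: aut_group_def B_def)
  have "R \<subseteq> carrier (aut_group \<Gamma>)"
    using subgroup.subset[OF R] aut by (auto simp: aut_group_def B_def BijGroup_def)
  then have "subgroup R (B\<lparr>carrier := carrier (aut_group \<Gamma>)\<rparr>)"
    using B.subgroup_incl[OF R] aut_group_subgroup[of \<Gamma>] by (simp add: B_def)
  then have 1: "subgroup R (aut_group \<Gamma>)"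
    using AB[of "carrier (aut_group \<Gamma>)"] by simp
  interpret R: group "B\<lparr>carrier := R\<rparr>" by (rule subgroup.subgroup_is_group[OF R B.is_group])
  have hom: "group_hom (B\<lparr>carrier := R\<rparr>) (BijGroup (verts \<Gamma>)) (\<lambda>g. g)"
  proof (intro group_hom.intro group_hom_axioms.intro R.is_group group_BijGroup homI)
    fix x assume "x \<in> carrier (B\<lparr>carrier := R\<rparr>)"
    then show "x \<in> carrier (BijGroup (verts \<Gamma>))"
      using subgroup.subset[OF R] by (auto simp: B_def)
  qed (simp add: B_def)
  have "transitive_action (B\<lparr>carrier := R\<rparr>) (verts \<Gamma>) (\<lambda>g. g)"
    by (intro transitive_action.intro group_action.intro hom transitive_action_axioms.intro)
      (use trans in simp)
  with 1 meta simple show ?thesis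
    unfolding weak_metacirculant_def AB by blast
qed

context petersen
begin

text \<open>The exponent \<open>b\<close> is not reduced modulo \<open>N\<close>: it acts on layers
  modulo \<open>N\<close> but on columns through \<open>l ^ b\<close>, whose period modulo
  \<open>M\<close> is \<open>p * N\<close>. Restriction to \<open>V\<close> gives the extensional
  functions that \<open>Bij\<close> demands.\<close>

definition act :: "int \<Rightarrow> nat \<Rightarrow> int \<times> nat \<Rightarrow> int \<times> nat" where
  "act c b = (\<lambda>v\<in>V. ((l ^ b * fst v + c) mod M, (snd v + b) mod N))"

lemma act_in_V: "v \<in> V \<Longrightarrow> act c b v \<in> V"
  using M_pos N_ge_3 by (simp add: act_def V_def mem_Times_iff)

lemma act_cong:
  assumes "[c = c'] (mod M)" "[l ^ b = l ^ b'] (mod M)" "[b = b'] (mod N)"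
  shows "act c b = act c' b'"
proof -
  have "(l ^ b * j + c) mod M = (l ^ b' * j + c') mod M" for j
    using cong_add[OF cong_mult[OF assms(2) cong_refl[of j]] assms(1)] by (simp add: cong_def)
  moreover have "(i + b) mod N = (i + b') mod N" for i
    using cong_add[OF cong_refl[of i] assms(3)] by (simp add: cong_def)
  ultimately show ?thesis unfolding act_def by auto
qed

lemma act_compose: "compose V (act c b) (act c' b') = act (c + l ^ b * c') (b + b')"
proof
  fix v
  show "compose V (act c b) (act c' b') v = act (c + l ^ b * c') (b + b') v"
  proof (cases "v \<in> V")
    case True
    have "(l ^ b * ((l ^ b' * fst v + c') mod M) + c) mod M
        = (l ^ (b + b') * fst v + (c + l ^ b * c')) mod M"
    proof -
      have "(l ^ b * ((l ^ b' * fst v + c') mod M) + c) mod M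
          = (l ^ b * (l ^ b' * fst v + c') + c) mod M"
        by (metis mod_add_left_eq mod_mult_right_eq)
      then show ?thesis by (simp add: power_add algebra_simps)
    qed
    moreover have "((snd v + b') mod N + b) mod N = (snd v + (b + b')) mod N"
      by (simp add: mod_simps algebra_simps)
    ultimately show ?thesis
      using True act_in_V[OF True, of c' b'] by (simp add: compose_eq) (simp add: act_def)
  qed (simp add: compose_def act_def)
qed

lemma act_0_0: "act 0 0 = (\<lambda>v\<in>V. v)"
  by (auto simp: act_def V_def fun_eq_iff)

lemma l_pow_period: "[l ^ (p ^ (n + 1) * k) = 1] (mod M)"
  by (simp add: l_pow_cong_1_mod_M_iff)

lemma act_period: "act 0 (p ^ (n + 1) * k) = act 0 0"
  by (rule act_cong) (use l_pow_period in \<open>auto simp: N_def cong_def\<close>)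

lemma act_inverse:
  obtains c' b' where "compose V (act c' b') (act c b) = act 0 0"
    "compose V (act c b) (act c' b') = act 0 0" "b + b' = p ^ (n + 1) * b"
proof
  \<comment> \<open>This natural number stands for \<open>- b\<close>: the sum \<open>b + b'\<close>
    is a multiple of the order of \<open>l\<close> modulo \<open>M\<close>, and so of
    \<open>N\<close>.\<close>
  define b' where "b' = (p ^ (n + 1) - 1) * b"
  define c' where "c' = - (l ^ b' * c)"
  have bb: "b + b' = p ^ (n + 1) * b"
    unfolding b'_def by (rule add_pred_mult) (use p_gt_1 in simp)
  then show "b + b' = p ^ (n + 1) * b" .
  show "compose V (act c' b') (act c b) = act 0 0"
  proof -
    have "compose V (act c' b') (act c b) = act 0 (b + b')"
      by (simp add: act_compose c'_def add.commute)
    also have "\<dots> = act 0 0" unfolding bb by (rule act_period)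
    finally show ?thesis .
  qed
  have "[c - l ^ (b + b') * c = c - 1 * c] (mod M)"
    unfolding bb by (intro cong_diff cong_mult cong_refl l_pow_period)
  then have c0: "act (c - l ^ (b + b') * c) (b + b') = act 0 (b + b')"
    by (intro act_cong[OF _ cong_refl cong_refl]) (simp only: mult_1 diff_self)
  show "compose V (act c b) (act c' b') = act 0 0"
  proof -
    have "compose V (act c b) (act c' b') = act (c - l ^ (b + b') * c) (b + b')"
      by (simp add: act_compose c'_def power_add mult.assoc)
    also have "\<dots> = act 0 (b + b')" by (rule c0)
    also have "\<dots> = act 0 0" unfolding bb by (rule act_period)
    finally show ?thesis .
  qed
qed

text \<open>Multiplication by \<open>l ^ b\<close> turns the step \<open>l ^ i\<close> of layer
  \<open>i\<close> into the step \<open>l ^ (i + b)\<close> of layer \<open>i + b\<close>; the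
  wrap-around of the layer index is harmless modulo \<open>Q\<close>.\<close>

lemma adj_act:
  assumes uv: "u \<in> V" "v \<in> V" and a: "adj u v"
  shows "adj (act c b u) (act c b v)"
  using a unfolding adj_def
proof
  assume la: "layer_adj u v"
  define i where "i = snd u"
  have e: "[l ^ b * fst v + c = l ^ b * fst u + c + e * l ^ ((i + b) mod N)] (mod Q)"
    if "[fst v = fst u + e * l ^ i] (mod Q)" for e
  proof -
    have "[l ^ b * fst v + c = l ^ b * (fst u + e * l ^ i) + c] (mod Q)"
      by (intro cong_add cong_mult cong_refl that)
    also have "l ^ b * (fst u + e * l ^ i) + c = l ^ b * fst u + c + e * l ^ (i + b)"
      by (simp add: algebra_simps power_add)
    also have "[l ^ b * fst u + c + e * l ^ (i + b) = l ^ b * fst u + c + e * l ^ ((i + b) mod N)] (mod Q)"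
      by (intro cong_add cong_mult cong_refl cong_sym[OF l_pow_mod_N])
    finally show ?thesis .
  qed
  have m: "[x mod M = y mod M + z] (mod Q)" if "[x = y + z] (mod Q)" for x y z
  proof -
    have mm: "[w mod M = w] (mod Q)" for w
      by (rule cong_M_imp_cong_Q) simp
    have "[y + z = y mod M + z] (mod Q)"
      by (intro cong_add cong_refl cong_sym[OF mm])
    with that mm[of x] show ?thesis using cong_trans by blast
  qed
  have "snd v = i" and "[fst v = fst u + 1 * l ^ i] (mod Q) \<or> [fst v = fst u + (- 1) * l ^ i] (mod Q)"
    using la by (auto simp: layer_adj_def i_def)
  then have "layer_adj (act c b u) (act c b v)"
    using e[THEN m, of 1] e[THEN m, of "- 1"] uv by (auto simp: layer_adj_def act_def i_def)
  then show "layer_adj (act c b u) (act c b v) \<or> cross_adj (act c b u) (act c b v)" ..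
next
  assume "cross_adj u v"
  then have "cross_adj (act c b u) (act c b v)"
    using uv by (auto simp: cross_adj_def act_def mod_simps)
  then show "layer_adj (act c b u) (act c b v) \<or> cross_adj (act c b u) (act c b v)" ..
qed

lemma act_Bij: "act c b \<in> Bij V"
  and graph_isomorphism_act: "graph_isomorphism \<Gamma> \<Gamma> (act c b)"
proof -
  obtain c' b' where 1: "compose V (act c' b') (act c b) = act 0 0"
    and 2: "compose V (act c b) (act c' b') = act 0 0"
    by (rule act_inverse)
  have inv: "act c' b' (act c b v) = v" "act c b (act c' b' v) = v" if "v \<in> V" for v
    using fun_cong[OF 1, of v] fun_cong[OF 2, of v] that act_0_0 by (simp_all add: compose_eq)
  have bij: "bij_betw (act c b) V V"
    by (rule bij_betwI[of _ _ _ "act c' b'"]) (use inv act_in_V in auto)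
  then show "act c b \<in> Bij V" by (simp add: Bij_def act_def)
  show "graph_isomorphism \<Gamma> \<Gamma> (act c b)"
    unfolding graph_isomorphism_def verts_MP
  proof (intro conjI bij ballI)
    fix u v assume uv: "u \<in> V" "v \<in> V"
    have "adj u v \<longleftrightarrow> adj (act c b u) (act c b v)"
      using adj_act[OF uv] adj_act[OF act_in_V act_in_V, OF uv, of c b c b c' b'] inv uv by auto
    then show "({u, v} \<in> edges \<Gamma>) = ({act c b u, act c b v} \<in> edges \<Gamma>)"
      using edge_iff_adj[OF uv] edge_iff_adj[OF act_in_V act_in_V, OF uv] by blast
  qed
qed

text \<open>The translations \<open>T\<close>, generated by \<open>act 1 0\<close>, form the cyclic
  normal subgroup of the group of all maps \<open>act c b\<close>, and the coset of
  \<open>act 0 1\<close> generates the quotient.\<close>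

lemma weak_metacirculant_MP: "weak_metacirculant \<Gamma>"
proof -
  define B where "B = BijGroup V"
  define R where "R = {act c b | c b. True}"
  define T where "T = {act c 0 | c. True}"
  interpret B: group B unfolding B_def by (rule group_BijGroup)
  have B_mult: "act c b \<otimes>\<^bsub>B\<^esub> act c' b' = act (c + l ^ b * c') (b + b')" for c b c' b'
    unfolding act_compose[symmetric] by (simp add: B_def BijGroup_def act_Bij)
  have B_carrier: "act c b \<in> carrier B" for c b
    by (simp add: B_def BijGroup_def act_Bij)
  have B_one: "\<one>\<^bsub>B\<^esub> = act 0 0" by (simp add: B_def BijGroup_def act_0_0)
  have R: "subgroup R B"
  proof (rule B.subgroupI)
    fix f assume "f \<in> R"
    then obtain c b where f: "f = act c b" by (auto simp: R_def)
    obtain c' b' where 1: "compose V (act c' b') (act c b) = act 0 0"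
      by (rule act_inverse)
    then have "act c' b' \<otimes>\<^bsub>B\<^esub> f = \<one>\<^bsub>B\<^esub>"
      unfolding f B_one by (simp add: B_def BijGroup_def act_Bij)
    then have "inv\<^bsub>B\<^esub> f = act c' b'" using B.inv_equality B_carrier f by metis
    then show "inv\<^bsub>B\<^esub> f \<in> R" by (auto simp: R_def)
  next
    show "R \<subseteq> carrier B" "R \<noteq> {}" using B_carrier by (auto simp: R_def)
    show "f \<otimes>\<^bsub>B\<^esub> g \<in> R" if "f \<in> R" "g \<in> R" for f g
      using that B_mult unfolding R_def by blast
  qed
  define H where "H = B\<lparr>carrier := R\<rparr>"
  interpret H: group H unfolding H_def by (rule subgroup.subgroup_is_group[OF R B.is_group])
  have H_carrier: "act c b \<in> carrier H" for c b by (auto simp: H_def R_def)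
  have H_mult: "act c b \<otimes>\<^bsub>H\<^esub> act c' b' = act (c + l ^ b * c') (b + b')" for c b c' b'
    by (simp add: H_def B_mult)
  have H_one: "\<one>\<^bsub>H\<^esub> = act 0 0" by (simp add: H_def B_one)
  have H_inv: "\<exists>c'. inv\<^bsub>H\<^esub> (act c b) = act c' ((p ^ (n + 1) - 1) * b)" for c b
  proof -
    obtain c' b' where 1: "compose V (act c' b') (act c b) = act 0 0"
      and 2: "b + b' = p ^ (n + 1) * b"
      by (rule act_inverse)
    have "act c' b' \<otimes>\<^bsub>H\<^esub> act c b = \<one>\<^bsub>H\<^esub>"
      using 1 unfolding H_one by (simp add: H_def B_def BijGroup_def act_Bij)
    then have "inv\<^bsub>H\<^esub> (act c b) = act c' b'" using H.inv_equality H_carrier by metis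
    moreover have "b' = (p ^ (n + 1) - 1) * b"
      using 2 add_pred_mult[of "p ^ (n + 1)" b] p_gt_1 by (metis add_left_cancel zero_less_power zero_less_one less_trans)
    ultimately show ?thesis by blast
  qed
  have T_pow: "act 1 0 [^]\<^bsub>H\<^esub> (k::nat) = act (int k) 0" for k
    by (induction k) (simp_all add: H_one H_mult add.commute)
  have b_pow: "act 0 1 [^]\<^bsub>H\<^esub> (k::nat) = act 0 k" for k
    by (induction k) (simp_all add: H_one H_mult)
  have T: "subgroup T H"
  proof (rule H.subgroupI)
    fix f assume "f \<in> T"
    then obtain c where "f = act c 0" by (auto simp: T_def)
    then show "inv\<^bsub>H\<^esub> f \<in> T" using H_inv[of c 0] by (auto simp: T_def)
  next
    show "T \<subseteq> carrier H" "T \<noteq> {}" using H_carrier by (auto simp: T_def)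
    show "f \<otimes>\<^bsub>H\<^esub> g \<in> T" if "f \<in> T" "g \<in> T" for f g
      using that H_mult[of _ 0 _ 0] unfolding T_def by force
  qed
  have normal: "T \<lhd> H"
  proof (rule H.normal_invI[OF T])
    fix f t assume "f \<in> carrier H" "t \<in> T"
    then obtain c b d where f: "f = act c b" and t: "t = act d 0" by (auto simp: H_def R_def T_def)
    obtain c' where inv: "inv\<^bsub>H\<^esub> f = act c' ((p ^ (n + 1) - 1) * b)" using H_inv f by blast
    \<comment> \<open>The layer exponents of \<open>f\<close> and its inverse add up to a period, so
      the conjugate is a translation.\<close>
    have "b + (p ^ (n + 1) - 1) * b = p ^ (n + 1) * b"
      by (rule add_pred_mult) (use p_gt_1 in simp)
    then obtain e where "f \<otimes>\<^bsub>H\<^esub> t \<otimes>\<^bsub>H\<^esub> inv\<^bsub>H\<^esub> f = act e (p ^ (n + 1) * b)"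
      unfolding inv unfolding f t by (auto simp: H_mult)
    also have "act e (p ^ (n + 1) * b) = act e 0"
      by (rule act_cong) (use l_pow_period in \<open>auto simp: N_def cong_def\<close>)
    finally show "f \<otimes>\<^bsub>H\<^esub> t \<otimes>\<^bsub>H\<^esub> inv\<^bsub>H\<^esub> f \<in> T" by (auto simp: T_def)
  qed
  interpret T: normal T H by (rule normal)
  interpret TG: group "H\<lparr>carrier := T\<rparr>" by (rule T.subgroup_is_group) (rule H.is_group)
  interpret QG: group "H Mod T" by (rule T.factorgroup_is_group)
  interpret pr: group_hom H "H Mod T" "\<lambda>x. T #>\<^bsub>H\<^esub> x"
    by unfold_locales (rule T.r_coset_hom_Mod)
  have "cyclic_group (H\<lparr>carrier := T\<rparr>)"
  proof (rule TG.cyclic_groupI)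
    show "act 1 0 \<in> carrier (H\<lparr>carrier := T\<rparr>)" by (auto simp: T_def)
    fix f assume "f \<in> carrier (H\<lparr>carrier := T\<rparr>)"
    then obtain c where f: "f = act c 0" by (auto simp: T_def)
    have "act c 0 = act (int (nat (c mod M))) 0"
      by (rule act_cong) (use M_pos in auto)
    then have "f = act 1 0 [^]\<^bsub>H\<lparr>carrier := T\<rparr>\<^esub> nat (c mod M)"
      by (simp add: H.nat_pow_consistent[symmetric] T_pow f)
    then show "\<exists>k::nat. f = act 1 0 [^]\<^bsub>H\<lparr>carrier := T\<rparr>\<^esub> k" by blast
  qed
  moreover have "cyclic_group (H Mod T)"
  proof (rule QG.cyclic_groupI)
    show "T #>\<^bsub>H\<^esub> act 0 1 \<in> carrier (H Mod T)" using H_carrier by (rule pr.hom_closed)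
    fix Z assume "Z \<in> carrier (H Mod T)"
    then obtain f where "f \<in> carrier H" "Z = T #>\<^bsub>H\<^esub> f" by (auto simp: FactGroup_def RCOSETS_def)
    then obtain c b where Z: "Z = T #>\<^bsub>H\<^esub> act c b" by (auto simp: H_def R_def)
    have cb: "act c b = act c 0 \<otimes>\<^bsub>H\<^esub> act 0 b" by (simp add: H_mult)
    have "Z = (T #>\<^bsub>H\<^esub> act c 0) \<otimes>\<^bsub>H Mod T\<^esub> (T #>\<^bsub>H\<^esub> act 0 b)"
      unfolding Z cb by (rule pr.hom_mult[OF H_carrier H_carrier])
    also have "T #>\<^bsub>H\<^esub> act c 0 = \<one>\<^bsub>H Mod T\<^esub>"
      using T.rcos_const[OF H.is_group] by (auto simp: T_def FactGroup_def)
    finally have "Z = T #>\<^bsub>H\<^esub> act 0 b"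
      using QG.l_one[OF pr.hom_closed[OF H_carrier, of 0 b]] by (rule trans)
    also have "\<dots> = (T #>\<^bsub>H\<^esub> act 0 1) [^]\<^bsub>H Mod T\<^esub> b"
      using pr.hom_nat_pow[OF H_carrier, of 0 1 b] b_pow by simp
    finally show "\<exists>k::nat. Z = (T #>\<^bsub>H\<^esub> act 0 1) [^]\<^bsub>H Mod T\<^esub> k" by blast
  qed
  ultimately have meta: "metacyclic_group H"
    unfolding metacyclic_group_def using normal H.is_group by blast
  have trans: "\<exists>f\<in>R. f u = v" if uv: "u \<in> V" "v \<in> V" for u v
  proof -
    \<comment> \<open>Adding \<open>N\<close> first keeps the subtraction of natural numbers from
      being truncated.\<close>
    define b where "b = snd v + N - snd u"
    have "(snd u + b) mod N = snd v" using uv by (auto simp: b_def V_def)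
    then have "act (fst v - l ^ b * fst u) b u = v"
      using uv by (auto simp: act_def V_def prod_eq_iff)
    then show ?thesis by (auto simp: R_def)
  qed
  show ?thesis
  proof (rule weak_metacirculantI[of "\<Gamma>" R, unfolded verts_MP])
    show "simple_graph \<Gamma>" by (rule simple_graph_MP)
    show "subgroup R (BijGroup V)" using R by (simp only: B_def)
    show "graph_isomorphism \<Gamma> \<Gamma> f" if "f \<in> R" for f
      using that graph_isomorphism_act unfolding R_def by blast
    show "metacyclic_group ((BijGroup V)\<lparr>carrier := R\<rparr>)"
      using meta by (simp only: H_def B_def)
  qed (rule trans)
qed

end

section \<open>A regular group of automorphisms\<close>

context petersen
begin

text \<open>Writing a column \<open>j\<close> as \<open>(j mod Q, j div Q)\<close> separates the metacirculant part of the graph,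
  on which \<open>l\<close> acts with order dividing \<open>N\<close>, from the position inside the fibre.  The group is the
  opposite of the group acting by automorphisms, since \<^const>\<open>Cay\<close> multiplies from the left.\<close>

definition cayley_group :: "(int \<times> int \<times> nat) monoid" where
  "cayley_group = \<lparr>carrier = {0..<Q} \<times> {0..<int p} \<times> {0..<N},
     monoid.mult = (\<lambda>(j, x, i) (j', x', i'). ((j' + l ^ i' * j) mod Q, (x + x') mod int p, (i + i') mod N)),
     one = (0, 0, 0)\<rparr>"

lemma cong_mod_self: "[a mod k = a] (mod k)" for a k :: int
  by (simp add: cong_def)

text \<open>The first part consists of the steps 1 and -1 with any position in the fibre, the second
  of the steps to the two neighbouring layers. The factor \<open>l ^ i\<close> of layer
  \<open>i\<close> is contributed by the group multiplication.\<close>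

definition cayley_set :: "(int \<times> int \<times> nat) set" where
  "cayley_set = {1, Q - 1} \<times> {0..<int p} \<times> {0} \<union> {(0, 0, 1), (0, 0, N - 1)}"

lemma cayley_mult [simp]: "(j, x, i) \<otimes>\<^bsub>cayley_group\<^esub> (j', x', i') =
    ((j' + l ^ i' * j) mod Q, (x + x') mod int p, (i + i') mod N)"
  by (simp add: cayley_group_def)

lemma cayley_one: "\<one>\<^bsub>cayley_group\<^esub> = (0, 0, 0)"
  by (simp add: cayley_group_def)

lemma cayley_carrier: "(j, x, i) \<in> carrier cayley_group \<longleftrightarrow> 0 \<le> j \<and> j < Q \<and> 0 \<le> x \<and> x < int p \<and> i < N"
  by (auto simp: cayley_group_def)

lemma Q_gt_2: "Q > 2"
proof -
  have "int p \<le> Q" using p_dvd_Q Q_pos by (rule zdvd_imp_le)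
  with p_ge_3 show ?thesis by simp
qed

lemma group_cayley_group: "group cayley_group"
proof (rule groupI)
  show "\<one>\<^bsub>cayley_group\<^esub> \<in> carrier cayley_group"
    using Q_pos p_gt_1 N_ge_3 by (simp add: cayley_one cayley_carrier)
next
  fix u v assume "u \<in> carrier cayley_group" "v \<in> carrier cayley_group"
  then show "u \<otimes>\<^bsub>cayley_group\<^esub> v \<in> carrier cayley_group"
    using Q_pos p_gt_1 N_ge_3 by (cases u; cases v) (simp add: cayley_carrier)
next
  fix u v w :: "int \<times> int \<times> nat"
  obtain j x i j' x' i' j'' x'' i'' where uvw: "u = (j, x, i)" "v = (j', x', i')" "w = (j'', x'', i'')"
    by (metis prod_cases3)
  \<comment> \<open>Associativity in the first coordinate rests on \<open>l ^ N = 1\<close> modulo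
    \<open>Q\<close>, which lets the layer exponent be reduced modulo \<open>N\<close>.\<close>
  have "[j'' + l ^ i'' * ((j' + l ^ i' * j) mod Q) = (j'' + l ^ i'' * j') mod Q + l ^ ((i' + i'') mod N) * j] (mod Q)"
  proof -
    have "[j'' + l ^ i'' * ((j' + l ^ i' * j) mod Q) = j'' + l ^ i'' * (j' + l ^ i' * j)] (mod Q)"
      by (intro cong_add cong_mult cong_refl cong_mod_self)
    also have "j'' + l ^ i'' * (j' + l ^ i' * j) = (j'' + l ^ i'' * j') + l ^ (i' + i'') * j"
      by (simp add: algebra_simps power_add)
    also have "[(j'' + l ^ i'' * j') + l ^ (i' + i'') * j
        = (j'' + l ^ i'' * j') mod Q + l ^ ((i' + i'') mod N) * j] (mod Q)"
      by (intro cong_add cong_mult cong_refl cong_sym[OF l_pow_mod_N] cong_sym[OF cong_mod_self])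
    finally show ?thesis .
  qed
  then show "u \<otimes>\<^bsub>cayley_group\<^esub> v \<otimes>\<^bsub>cayley_group\<^esub> w = u \<otimes>\<^bsub>cayley_group\<^esub> (v \<otimes>\<^bsub>cayley_group\<^esub> w)"
    unfolding uvw by (simp add: cong_def mod_simps algebra_simps)
next
  fix u assume u: "u \<in> carrier cayley_group"
  then show "\<one>\<^bsub>cayley_group\<^esub> \<otimes>\<^bsub>cayley_group\<^esub> u = u"
    by (cases u) (simp add: cayley_carrier cayley_one)
  obtain j x i where e: "u = (j, x, i)" by (metis prod_cases3)
  let ?v = "((- (l ^ (N - i) * j)) mod Q, (- x) mod int p, (N - i) mod N)"
  have i: "i < N" "N - i + i = N" using u by (simp_all add: e cayley_carrier)
  have "[j + l ^ i * ((- (l ^ (N - i) * j)) mod Q) = 0] (mod Q)"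
  proof -
    have "[j + l ^ i * ((- (l ^ (N - i) * j)) mod Q) = j + l ^ i * (- (l ^ (N - i) * j))] (mod Q)"
      by (intro cong_add cong_mult cong_refl cong_mod_self)
    also have "j + l ^ i * (- (l ^ (N - i) * j)) = j - l ^ (N - i + i) * j"
      by (simp add: power_add mult_ac)
    also have "[\<dots> = j - 1 * j] (mod Q)"
      unfolding i(2) by (intro cong_diff cong_mult cong_refl l_pow_N_cong_Q)
    finally show ?thesis by simp
  qed
  then have "?v \<otimes>\<^bsub>cayley_group\<^esub> u = \<one>\<^bsub>cayley_group\<^esub>"
    using i by (simp add: e cayley_one cong_def mod_simps)
  moreover have "?v \<in> carrier cayley_group"
    using Q_pos p_gt_1 N_ge_3 by (simp add: cayley_carrier)
  ultimately show "\<exists>v\<in>carrier cayley_group. v \<otimes>\<^bsub>cayley_group\<^esub> u = \<one>\<^bsub>cayley_group\<^esub>" by blast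
qed

lemma connection_set_cayley: "connection_set cayley_group cayley_set"
  unfolding connection_set_def
proof (intro conjI ballI)
  interpret group cayley_group by (rule group_cayley_group)
  show sub: "cayley_set \<subseteq> carrier cayley_group - {\<one>\<^bsub>cayley_group\<^esub>}"
    using Q_gt_2 p_gt_1 N_ge_3 by (auto simp: cayley_set_def cayley_one cayley_carrier)
  fix s assume s: "s \<in> cayley_set"
  have "\<exists>s'\<in>cayley_set. s' \<otimes>\<^bsub>cayley_group\<^esub> s = \<one>\<^bsub>cayley_group\<^esub>"
  proof -
    consider a x where "s = (a, x, 0)" "a = 1 \<or> a = Q - 1" "0 \<le> x" "x < int p" | "s = (0, 0, 1)" | "s = (0, 0, N - 1)"
      using s by (auto simp: cayley_set_def)
    then show ?thesis
    proof cases
      case 1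
      have "(Q - a, (- x) mod int p, 0) \<in> cayley_set"
        using 1 p_gt_1 by (auto simp: cayley_set_def)
      moreover have "(Q - a, (- x) mod int p, 0) \<otimes>\<^bsub>cayley_group\<^esub> s = \<one>\<^bsub>cayley_group\<^esub>"
        using 1 by (simp add: cayley_one mod_simps)
      ultimately show ?thesis by blast
    next
      case 2
      have "(0, 0, N - 1) \<in> cayley_set" by (simp add: cayley_set_def)
      moreover have "(0, 0, N - 1) \<otimes>\<^bsub>cayley_group\<^esub> s = \<one>\<^bsub>cayley_group\<^esub>"
        using 2 N_ge_3 by (simp add: cayley_one)
      ultimately show ?thesis by blast
    next
      case 3
      have "(0, 0, 1) \<in> cayley_set" by (simp add: cayley_set_def)
      moreover have "(0, 0, 1) \<otimes>\<^bsub>cayley_group\<^esub> s = \<one>\<^bsub>cayley_group\<^esub>"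
        using 3 N_ge_3 by (simp add: cayley_one)
      ultimately show ?thesis by blast
    qed
  qed
  then obtain s' where s': "s' \<in> cayley_set" "s' \<otimes>\<^bsub>cayley_group\<^esub> s = \<one>\<^bsub>cayley_group\<^esub>" by blast
  have "inv\<^bsub>cayley_group\<^esub> s = s'"
    by (rule inv_equality[OF s'(2)]) (use sub s s' in auto)
  with s' show "inv\<^bsub>cayley_group\<^esub> s \<in> cayley_set" by simp
qed

definition cayley_iso :: "int \<times> nat \<Rightarrow> int \<times> int \<times> nat" where
  "cayley_iso v = (fst v mod Q, fst v div Q, snd v)"

lemma cayley_iso_bij: "bij_betw cayley_iso V (carrier cayley_group)"
proof (rule bij_betwI[of _ _ _ "\<lambda>(j, x, i). (j + Q * x, i)"])
  show "cayley_iso \<in> V \<rightarrow> carrier cayley_group"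
  proof
    fix v assume v: "v \<in> V"
    then have "0 \<le> fst v" "fst v < int p * Q" by (auto simp: V_def M_eq)
    moreover have "fst v div Q * Q \<le> fst v"
      using Q_pos by (metis div_mult_mod_eq le_add_same_cancel1 pos_mod_sign)
    ultimately have "fst v div Q * Q < int p * Q" by linarith
    then have "fst v div Q < int p" using Q_pos mult_less_cancel_right_pos by blast
    moreover have "0 \<le> fst v div Q"
      using v Q_pos by (simp add: V_def mem_Times_iff pos_imp_zdiv_nonneg_iff)
    ultimately have "0 \<le> fst v div Q" "fst v div Q < int p" by blast+
    with v show "cayley_iso v \<in> carrier cayley_group"
      using v Q_pos by (auto simp: cayley_iso_def cayley_carrier V_def)
  qed
  show "(\<lambda>(j, x, i). (j + Q * x, i)) \<in> carrier cayley_group \<rightarrow> V"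
  proof
    fix u assume u: "u \<in> carrier cayley_group"
    obtain j x i where e: "u = (j, x, i)" by (metis prod_cases3)
    have "Q * x \<le> Q * (int p - 1)" using u Q_pos by (simp add: e cayley_carrier)
    then have "j + Q * x < M" using u by (simp add: e cayley_carrier M_eq algebra_simps)
    then show "(\<lambda>(j, x, i). (j + Q * x, i)) u \<in> V"
      using u Q_pos by (simp add: e cayley_carrier V_def)
  qed
qed (auto simp: cayley_iso_def cayley_carrier)

lemma cayley_step_layer:
  assumes "u \<in> V" "v \<in> V"
  shows "layer_adj u v \<longleftrightarrow> (\<exists>s\<in>{1, Q - 1} \<times> {0..<int p} \<times> {0}. cayley_iso v = s \<otimes>\<^bsub>cayley_group\<^esub> cayley_iso u)"
proof -
  obtain j i j' i' where u: "u = (j, i)" and v: "v = (j', i')" by fastforce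
  \<comment> \<open>The fibre coordinate imposes no condition, as some \<open>y\<close> always moves
    \<open>x\<close> to \<open>x'\<close>; only the congruence modulo \<open>Q\<close>
    remains.\<close>
  have R: "(\<exists>y\<in>{0..<int p}. x' = (y + x) mod int p) \<longleftrightarrow> True" if "0 \<le> x'" "x' < int p" for x x'
    using that by (auto intro!: bexI[of _ "(x' - x) mod int p"] simp: mod_simps)
  have x: "0 \<le> j' div Q" "j' div Q < int p"
    using bij_betwE[OF cayley_iso_bij] assms(2) by (auto simp: v cayley_iso_def cayley_carrier)
  have i: "i < N" using assms(1) by (simp add: u V_def)
  have "(\<exists>s\<in>{1, Q - 1} \<times> {0..<int p} \<times> {0}. cayley_iso v = s \<otimes>\<^bsub>cayley_group\<^esub> cayley_iso u) \<longleftrightarrow>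
    i' = i \<and> (\<exists>a\<in>{1, Q - 1}. j' mod Q = (j mod Q + l ^ i * a) mod Q) \<and>
      (\<exists>y\<in>{0..<int p}. j' div Q = (y + j div Q) mod int p)"
    using i unfolding u v cayley_iso_def by auto
  also have "\<dots> \<longleftrightarrow> i' = i \<and> (\<exists>a\<in>{1, Q - 1}. j' mod Q = (j mod Q + l ^ i * a) mod Q)"
    using R[OF x] by simp
  also have "\<dots> \<longleftrightarrow> i' = i \<and> ([j' = j + l ^ i] (mod Q) \<or> [j' = j - l ^ i] (mod Q))"
  proof -
    have "(j mod Q + l ^ i * (Q - 1)) mod Q = (j - l ^ i) mod Q"
    proof -
      have "[j mod Q + l ^ i * (Q - 1) = j + l ^ i * (0 - 1)] (mod Q)"
        by (intro cong_add cong_mult cong_diff cong_refl cong_mod_self) (simp add: cong_0_iff)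
      then show ?thesis by (simp add: cong_def)
    qed
    then show ?thesis by (simp add: cong_def mod_simps)
  qed
  also have "\<dots> \<longleftrightarrow> layer_adj u v" by (auto simp: layer_adj_def u v)
  finally show ?thesis ..
qed

lemma cayley_step_cross:
  assumes "u \<in> V" "v \<in> V"
  shows "cross_adj u v \<longleftrightarrow> (\<exists>s\<in>{(0, 0, 1), (0, 0, N - 1)}. cayley_iso v = s \<otimes>\<^bsub>cayley_group\<^esub> cayley_iso u)"
proof -
  obtain j i j' i' where u: "u = (j, i)" and v: "v = (j', i')" by fastforce
  have i: "i < N" "i' < N" using assms by (simp_all add: u v V_def)
  have x: "j div Q mod int p = j div Q"
    using bij_betwE[OF cayley_iso_bij] assms(1) by (auto simp: u cayley_iso_def cayley_carrier)
  have j: "j' mod Q = j mod Q \<and> j' div Q = j div Q \<longleftrightarrow> j = j'"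
    by (metis div_mult_mod_eq)
  have "i' = (N - 1 + i) mod N \<longleftrightarrow> i = Suc i' mod N"
    using i by (cases "i = 0"; cases "Suc i' = N") (auto simp: mod_if)
  then show ?thesis
    using x j by (auto simp: u v cayley_iso_def cross_adj_def)
qed

lemma Cayley_graph_MP: "Cayley_graph \<Gamma>"
proof (rule Cayley_graphI[OF simple_graph_MP group_cayley_group connection_set_cayley])
  interpret group cayley_group by (rule group_cayley_group)
  have S: "cayley_set \<subseteq> carrier cayley_group" "\<And>s. s \<in> cayley_set \<Longrightarrow> inv\<^bsub>cayley_group\<^esub> s \<in> cayley_set"
    using connection_set_cayley by (auto simp: connection_set_def)
  \<comment> \<open>Closure of the connection set under inverses allows an edge to be read in the
    direction from \<open>g\<close> to \<open>h\<close>.\<close>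
  have Cay: "{g, h} \<in> edges (Cay cayley_group cayley_set) \<longleftrightarrow> (\<exists>s\<in>cayley_set. h = s \<otimes>\<^bsub>cayley_group\<^esub> g)"
    if gh: "g \<in> carrier cayley_group" "h \<in> carrier cayley_group" for g h
  proof
    assume "{g, h} \<in> edges (Cay cayley_group cayley_set)"
    then obtain s where s: "s \<in> cayley_set"
      and "h = s \<otimes>\<^bsub>cayley_group\<^esub> g \<or> g = s \<otimes>\<^bsub>cayley_group\<^esub> h"
      by (auto simp: Cay_def doubleton_eq_iff)
    then show "\<exists>s\<in>cayley_set. h = s \<otimes>\<^bsub>cayley_group\<^esub> g"
    proof (elim disjE)
      assume "g = s \<otimes>\<^bsub>cayley_group\<^esub> h"
      then have "h = inv\<^bsub>cayley_group\<^esub> s \<otimes>\<^bsub>cayley_group\<^esub> g"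
        using subsetD[OF S(1) s] gh(2) by (simp flip: m_assoc)
      then show ?thesis using S(2) s by blast
    qed (use s in blast)
  next
    assume "\<exists>s\<in>cayley_set. h = s \<otimes>\<^bsub>cayley_group\<^esub> g"
    then show "{g, h} \<in> edges (Cay cayley_group cayley_set)"
      using gh by (simp only: Cay_def ugraph.simps mem_Collect_eq) blast
  qed
  have "graph_isomorphism \<Gamma> (Cay cayley_group cayley_set) cayley_iso"
    unfolding graph_isomorphism_def verts_MP
  proof (intro conjI ballI)
    show "bij_betw cayley_iso V (verts (Cay cayley_group cayley_set))"
      using cayley_iso_bij by (simp add: Cay_def)
    fix u v assume uv: "u \<in> V" "v \<in> V"
    have im: "cayley_iso w \<in> carrier cayley_group" if "w \<in> V" for w
      using bij_betwE[OF cayley_iso_bij] that by blast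
    show "({u, v} \<in> edges \<Gamma>) = ({cayley_iso u, cayley_iso v} \<in> edges (Cay cayley_group cayley_set))"
      unfolding edge_iff_adj[OF uv] Cay[OF im im, OF uv] adj_def
        cayley_step_layer[OF uv] cayley_step_cross[OF uv]
      by (simp only: cayley_set_def bex_Un)
  qed
  then show "isomorphic_graphs \<Gamma> (Cay cayley_group cayley_set)"
    unfolding isomorphic_graphs_def by blast
qed

end

section \<open>Automorphisms of the graph\<close>

lemma Suc_mod_eq_iff:
  assumes "a < N" "b < N"
  shows "Suc a mod N = Suc b mod N \<longleftrightarrow> a = b"
  using assms by (cases "Suc a = N"; cases "Suc b = N") auto

context petersen
begin

section \<open>Recovering fibres and layer edges from adjacency\<close>

definition same_fibre :: "int \<times> nat \<Rightarrow> int \<times> nat \<Rightarrow> bool" where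
  "same_fibre u v \<longleftrightarrow> snd u = snd v \<and> [fst u = fst v] (mod Q)"

lemma layer_adj_fibre:
  assumes "same_fibre v w" shows "layer_adj u v \<longleftrightarrow> layer_adj u w"
  using assms unfolding layer_adj_def same_fibre_def cong_def by auto

lemma layer_not_cross: "u \<in> V \<Longrightarrow> layer_adj u v \<Longrightarrow> \<not> cross_adj u v"
  using mod_N_neq[of "snd u"] by (auto simp: layer_adj_def cross_adj_def V_def)

text \<open>A fibre has \<open>p \<ge> 3\<close> points. Three are what it takes to defeat a
  criterion that tolerates two exceptional vertices.\<close>

lemma fibre_three_points:
  assumes i: "i < N"
  obtains w1 w2 w3 where "w1 \<in> V" "w2 \<in> V" "w3 \<in> V" "w1 \<noteq> w2" "w1 \<noteq> w3" "w2 \<noteq> w3"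
    "\<And>w. w \<in> {w1, w2, w3} \<Longrightarrow> snd w = i \<and> [fst w = a] (mod Q)"
proof -
  define P where "P k = ((a + k * Q) mod M, i)" for k :: int
  have V: "P k \<in> V" for k using M_pos i by (simp add: P_def V_def)
  have S: "snd (P k) = i \<and> [fst (P k) = a] (mod Q)" for k
  proof -
    have "[fst (P k) = a + k * Q] (mod Q)"
      unfolding P_def by (rule cong_M_imp_cong_Q) simp
    then show ?thesis by (simp add: cong_def P_def)
  qed
  have inj: "P k \<noteq> P k'" if "\<bar>k - k'\<bar> < int p" "k \<noteq> k'" for k k'
  proof
    assume "P k = P k'"
    then have "M dvd (a + k * Q) - (a + k' * Q)" by (simp add: P_def mod_eq_dvd_iff)
    then have "int p * Q dvd (k - k') * Q" by (simp add: M_eq algebra_simps)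
    then have "int p dvd k - k'" using Q_pos by simp
    moreover have "k - k' \<noteq> 0" using that(2) by simp
    ultimately have "\<bar>int p\<bar> \<le> \<bar>k - k'\<bar>" by (rule dvd_imp_le_int[rotated])
    with that(1) show False by simp
  qed
  show thesis
  proof (rule that[of "P 0" "P 1" "P 2"])
    show "P 0 \<noteq> P 1" "P 0 \<noteq> P 2" "P 1 \<noteq> P 2"
      using p_ge_3 inj[of 0 1] inj[of 0 2] inj[of 1 2] by simp_all
    show "snd w = i \<and> [fst w = a] (mod Q)" if "w \<in> {P 0, P 1, P 2}" for w
      using that S by blast
  qed (rule V)+
qed

text \<open>The right-hand side mentions adjacency only, so automorphisms preserve fibres.\<close>

lemma same_fibre_iff:
  assumes u: "u \<in> V" and v: "v \<in> V"
  shows "same_fibre u v \<longleftrightarrow> (\<exists>a b. \<forall>w\<in>V. adj u w \<and> \<not> adj v w \<longrightarrow> w = a \<or> w = b)"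
proof
  assume f: "same_fibre u v"
  \<comment> \<open>Vertices of one fibre share their layer neighbours, so only the two cross
    neighbours of \<open>u\<close> can be exceptions.\<close>
  have "w = (fst u, Suc (snd u) mod N) \<or> w = (fst u, (snd u + N - 1) mod N)"
    if w: "w \<in> V" "adj u w" "\<not> adj v w" for w
  proof -
    have "\<not> layer_adj u w"
      using w layer_adj_fibre[OF f, of w] layer_adj_sym by (auto simp: adj_def)
    then have c: "cross_adj u w" using w by (simp add: adj_def)
    have "snd w = (snd u + N - 1) mod N" if "snd u = Suc (snd w) mod N"
    proof -
      have "snd w < N" using w by (auto simp: V_def)
      then show ?thesis unfolding that by (cases "Suc (snd w) = N") auto
    qed
    with c show ?thesis by (auto simp: cross_adj_def prod_eq_iff)
  qed
  then show "\<exists>a b. \<forall>w\<in>V. adj u w \<and> \<not> adj v w \<longrightarrow> w = a \<or> w = b" by blast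
next
  assume ex: "\<exists>a b. \<forall>w\<in>V. adj u w \<and> \<not> adj v w \<longrightarrow> w = a \<or> w = b"
  show "same_fibre u v"
  proof (rule ccontr)
    assume nf: "\<not> same_fibre u v"
    define i d where "i = snd u" and "d = l ^ i"
    have iN: "i < N" using u by (auto simp: i_def V_def)
    have d: "\<not> Q dvd 2 * d" "\<not> Q dvd 4 * d"
      unfolding d_def by (rule not_cong_Q_if_cong_1[OF l_pow_cong_1])+
    \<comment> \<open>The layer neighbours of \<open>u\<close> fill two fibres; one of them avoids
      all neighbours of \<open>v\<close>, and its points are too many exceptions. If
      \<open>v\<close> lies in another layer, its column cannot belong to both fibres unless
      \<open>Q dvd 2 * d\<close>. In the same layer, failure of both signs would give
      \<open>Q dvd 4 * d\<close>.\<close>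
    have "\<exists>e. (e = 1 \<or> e = - 1) \<and> (\<forall>w\<in>V. snd w = i \<and> [fst w = fst u + e * d] (mod Q) \<longrightarrow> \<not> adj v w)"
    proof (cases "snd v = i")
      case False
      have na: "\<not> adj v w" if "snd w = i" "\<not> [fst v = fst u + e * d] (mod Q)"
          "[fst w = fst u + e * d] (mod Q)" for w e
        using that False by (auto simp: adj_def layer_adj_def cross_adj_def)
      have "\<not> ([fst v = fst u + 1 * d] (mod Q) \<and> [fst v = fst u + (- 1) * d] (mod Q))"
      proof
        assume "[fst v = fst u + 1 * d] (mod Q) \<and> [fst v = fst u + (- 1) * d] (mod Q)"
        then have "[fst u + 1 * d = fst u + (- 1) * d] (mod Q)" using cong_sym cong_trans by blast
        then show False using d(1) by (simp add: cong_iff_dvd_diff algebra_simps)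
      qed
      then show ?thesis using na by blast
    next
      case True
      then have ne: "\<not> Q dvd fst u - fst v" using nf by (simp add: same_fibre_def i_def cong_iff_dvd_diff)
      have "\<exists>e. (e = 1 \<or> e = - 1) \<and> \<not> [fst u + e * d = fst v + d] (mod Q) \<and> \<not> [fst u + e * d = fst v - d] (mod Q)"
      proof (rule ccontr)
        assume "\<not> ?thesis"
        then have 1: "[fst u + d = fst v + d] (mod Q) \<or> [fst u + d = fst v - d] (mod Q)"
          and 2: "[fst u - d = fst v + d] (mod Q) \<or> [fst u - d = fst v - d] (mod Q)" by force+
        from 1 ne have "Q dvd (fst u + d) - (fst v - d)" by (auto simp: cong_iff_dvd_diff)
        moreover from 2 ne have "Q dvd (fst u - d) - (fst v + d)" by (auto simp: cong_iff_dvd_diff)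
        ultimately have "Q dvd ((fst u + d) - (fst v - d)) - ((fst u - d) - (fst v + d))" by (rule dvd_diff)
        then show False using d(2) by (simp add: algebra_simps)
      qed
      then obtain e where e: "e = 1 \<or> e = - 1" "\<not> [fst u + e * d = fst v + d] (mod Q)"
        "\<not> [fst u + e * d = fst v - d] (mod Q)" by blast
      have "\<not> adj v w" if w: "w \<in> V" "snd w = i" "[fst w = fst u + e * d] (mod Q)" for w
      proof -
        have "\<not> layer_adj v w"
          using w e True by (auto simp: layer_adj_def d_def cong_def)
        moreover have "\<not> cross_adj v w"
          using w True mod_N_neq[OF iN] by (auto simp: cross_adj_def)
        ultimately show ?thesis by (simp add: adj_def)
      qed
      with e(1) show ?thesis by blast
    qed
    then obtain e where e: "e = 1 \<or> e = - 1"
      and na: "\<And>w. w \<in> V \<Longrightarrow> snd w = i \<and> [fst w = fst u + e * d] (mod Q) \<Longrightarrow> \<not> adj v w" by blast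
    obtain w1 w2 w3 where w: "w1 \<in> V" "w2 \<in> V" "w3 \<in> V" "w1 \<noteq> w2" "w1 \<noteq> w3" "w2 \<noteq> w3"
      "\<And>w. w \<in> {w1, w2, w3} \<Longrightarrow> snd w = i \<and> [fst w = fst u + e * d] (mod Q)"
      using fibre_three_points[OF iN, of "fst u + e * d"] by metis
    have "adj u w \<and> \<not> adj v w" if "w \<in> {w1, w2, w3}" for w
    proof -
      have "layer_adj u w"
        using w(7)[OF that] e by (auto simp: layer_adj_def i_def d_def)
      moreover have "w \<in> V" using that w(1-3) by blast
      ultimately show ?thesis using na w(7)[OF that] by (simp add: adj_def)
    qed
    with ex w(1-6) show False by (metis insertI1 insertI2)
  qed
qed

text \<open>Cross edges keep the column exactly, so they reach at most one vertex of a given fibre,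
  whereas layer edges reach the whole fibre or none of it.\<close>

lemma layer_adj_iff:
  assumes u: "u \<in> V" and v: "v \<in> V"
  shows "layer_adj u v \<longleftrightarrow> adj u v \<and> (\<forall>w\<in>V. same_fibre v w \<longrightarrow> adj u w)"
proof
  assume "layer_adj u v"
  then show "adj u v \<and> (\<forall>w\<in>V. same_fibre v w \<longrightarrow> adj u w)"
    using layer_adj_fibre unfolding adj_def by blast
next
  assume r: "adj u v \<and> (\<forall>w\<in>V. same_fibre v w \<longrightarrow> adj u w)"
  show "layer_adj u v"
  proof (rule ccontr)
    assume nl: "\<not> layer_adj u v"
    have i: "snd v < N" using v by (auto simp: V_def)
    obtain w1 w2 w3 where w: "w1 \<in> V" "w2 \<in> V" "w1 \<noteq> w2"
      "\<And>w. w \<in> {w1, w2, w3} \<Longrightarrow> snd w = snd v \<and> [fst w = fst v] (mod Q)"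
      using fibre_three_points[OF i, of "fst v"] by metis
    have f: "same_fibre v w" if "w \<in> {w1, w2}" for w
      using w(4)[of w] that by (auto simp: same_fibre_def cong_sym_eq)
    have "fst w = fst u" if "w \<in> {w1, w2}" for w
    proof -
      have "\<not> layer_adj u w" using layer_adj_fibre[OF f[OF that]] nl by blast
      moreover have "adj u w" using r f[OF that] that w by blast
      ultimately show ?thesis by (simp add: adj_def cross_adj_def)
    qed
    then have "fst w1 = fst w2" by simp
    moreover have "snd w1 = snd w2" using w(4)[of w1] w(4)[of w2] by simp
    ultimately have "w1 = w2" by (rule prod_eqI)
    with w show False by blast
  qed
qed

end

section \<open>The action of an automorphism on columns and layers\<close>

locale petersen_automorphism = petersen +
  fixes g :: "int \<times> nat \<Rightarrow> int \<times> nat"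
  assumes aut: "graph_isomorphism \<Gamma> \<Gamma> g"
begin

lemma g_bij: "bij_betw g V V"
  using aut by (simp only: graph_isomorphism_def verts_MP)

lemma g_V: "v \<in> V \<Longrightarrow> g v \<in> V"
  using g_bij bij_betwE by blast

lemma g_inj: "u \<in> V \<Longrightarrow> v \<in> V \<Longrightarrow> g u = g v \<longleftrightarrow> u = v"
  using g_bij by (auto simp: bij_betw_def inj_on_eq_iff)

lemma g_adj: "u \<in> V \<Longrightarrow> v \<in> V \<Longrightarrow> adj (g u) (g v) \<longleftrightarrow> adj u v"
  using aut edge_iff_adj g_V unfolding graph_isomorphism_def verts_MP by metis

lemma ball_g: "(\<forall>w\<in>V. P w) \<longleftrightarrow> (\<forall>w\<in>V. P (g w))"
  using bij_betw_imp_surj_on[OF g_bij] by (metis imageE imageI)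

lemma g_same_fibre:
  assumes u: "u \<in> V" and v: "v \<in> V"
  shows "same_fibre (g u) (g v) \<longleftrightarrow> same_fibre u v"
proof -
  have "same_fibre (g u) (g v) \<longleftrightarrow> (\<exists>a b. \<forall>w\<in>V. adj u w \<and> \<not> adj v w \<longrightarrow> g w = a \<or> g w = b)"
    unfolding same_fibre_iff[OF g_V g_V, OF u v] ball_g[of "\<lambda>w. adj (g u) w \<and> _ w \<longrightarrow> _ w"]
    using g_adj u v by (intro ex_cong1 ball_cong) auto
  also have "\<dots> \<longleftrightarrow> same_fibre u v"
    unfolding same_fibre_iff[OF u v]
  proof
    assume "\<exists>a b. \<forall>w\<in>V. adj u w \<and> \<not> adj v w \<longrightarrow> g w = a \<or> g w = b"
    then obtain a b where ab: "\<forall>w\<in>V. adj u w \<and> \<not> adj v w \<longrightarrow> g w = a \<or> g w = b" by blast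
    have "inv_into V g (g w) = w" if "w \<in> V" for w
      using g_bij that by (simp add: bij_betw_def inv_into_f_f)
    \<comment> \<open>The witnesses \<open>a\<close> and \<open>b\<close> may lie outside
      \<open>V\<close>, where \<open>inv_into\<close> takes some arbitrary value; it is only used
      where \<open>a\<close> or \<open>b\<close> is an image \<open>g w\<close>.\<close>
    then have "\<forall>w\<in>V. adj u w \<and> \<not> adj v w \<longrightarrow> w = inv_into V g a \<or> w = inv_into V g b"
      using ab by metis
    then show "\<exists>a b. \<forall>w\<in>V. adj u w \<and> \<not> adj v w \<longrightarrow> w = a \<or> w = b" by blast
  qed blast
  finally show ?thesis .
qed

lemma g_layer_adj:
  assumes u: "u \<in> V" and v: "v \<in> V"
  shows "layer_adj (g u) (g v) \<longleftrightarrow> layer_adj u v"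
proof -
  have "(\<forall>w\<in>V. same_fibre (g v) w \<longrightarrow> adj (g u) w) \<longleftrightarrow> (\<forall>w\<in>V. same_fibre v w \<longrightarrow> adj u w)"
    using ball_g[of "\<lambda>w. same_fibre (g v) w \<longrightarrow> adj (g u) w"] g_same_fibre[OF v] g_adj[OF u] by auto
  then show ?thesis
    unfolding layer_adj_iff[OF u v] layer_adj_iff[OF g_V g_V, OF u v] g_adj[OF u v] by blast
qed

lemma g_cross_adj:
  assumes u: "u \<in> V" and v: "v \<in> V"
  shows "cross_adj (g u) (g v) \<longleftrightarrow> cross_adj u v"
  using g_layer_adj[OF u v] g_adj[OF u v] layer_not_cross[OF u] layer_not_cross[OF g_V[OF u]]
  unfolding adj_def by blast

text \<open>The induced maps on columns and layers are read off at the representatives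
  \<open>(j, 0)\<close> and \<open>(0, i)\<close>; \<open>fst_g\<close> and \<open>snd_g\<close>
  show that any other vertex gives the same value.\<close>

definition \<alpha> where "\<alpha> j = fst (g (j, 0))"
definition \<beta> where "\<beta> i = snd (g (0, i))"

lemma V_iff: "(j, i) \<in> V \<longleftrightarrow> 0 \<le> j \<and> j < M \<and> i < N"
  by (auto simp: V_def)

text \<open>Cross edges are preserved and keep the column, and a column is a path of cross edges
  starting at \<open>(j, 0)\<close>.\<close>

lemma fst_g:
  assumes "(j, i) \<in> V" shows "fst (g (j, i)) = \<alpha> j"
  using assms
proof (induction i)
  case (Suc i)
  then have V: "(j, i) \<in> V" by (simp add: V_iff)
  have "cross_adj (j, i) (j, Suc i)" using Suc.prems by (simp add: cross_adj_def V_iff)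
  then have "cross_adj (g (j, i)) (g (j, Suc i))" using g_cross_adj[OF V Suc.prems] by blast
  with Suc.IH[OF V] show ?case by (simp add: cross_adj_def)
qed (simp add: \<alpha>_def)

text \<open>Layer edges are preserved and keep the layer. Walking from \<open>(0, i)\<close> in
  steps of \<open>l ^ i\<close> reaches every column, because \<open>l ^ i\<close> is a unit modulo
  \<open>M\<close>.\<close>

lemma snd_g:
  assumes "(j, i) \<in> V" shows "snd (g (j, i)) = \<beta> i"
proof -
  have i: "i < N" using assms by (simp add: V_iff)
  have in_V: "(x mod M, i) \<in> V" for x using i M_pos by (simp add: V_iff)
  have step: "snd (g ((int k * l ^ i) mod M, i)) = \<beta> i" for k
  proof (induction k)
    case (Suc k)
    have "[(int (Suc k) * l ^ i) mod M = int k * l ^ i mod M + l ^ i] (mod M)"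
      by (simp add: cong_def algebra_simps mod_simps)
    then have "layer_adj ((int k * l ^ i) mod M, i) ((int (Suc k) * l ^ i) mod M, i)"
      using cong_M_imp_cong_Q by (simp add: layer_adj_def)
    then have "layer_adj (g ((int k * l ^ i) mod M, i)) (g ((int (Suc k) * l ^ i) mod M, i))"
      using g_layer_adj[OF in_V in_V] by blast
    with Suc show ?case by (simp add: layer_adj_def)
  qed (simp add: \<beta>_def)
  obtain x where x: "[l ^ i * x = 1] (mod M)"
    using cong_solve_coprime_int[of "l ^ i" M] coprime_if_cong_1(2)[OF l_pow_cong_1] by blast
  define k where "k = nat ((x * j) mod M)"
  have "[int k * l ^ i = (x * j) * l ^ i] (mod M)"
    using M_pos by (intro cong_mult cong_refl) (simp add: k_def)
  also have "(x * j) * l ^ i = (l ^ i * x) * j" by simp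
  also have "[(l ^ i * x) * j = 1 * j] (mod M)" by (intro cong_mult cong_refl x)
  finally have "(int k * l ^ i) mod M = j" using assms by (simp add: V_iff cong_def)
  with step[of k] show ?thesis by simp
qed

lemma g_eq: "(j, i) \<in> V \<Longrightarrow> g (j, i) = (\<alpha> j, \<beta> i)"
  using fst_g snd_g by (simp add: prod_eq_iff)

lemma zero_V: "i < N \<Longrightarrow> (0, i) \<in> V"
  using M_pos by (simp add: V_iff)

lemma \<beta>_less: "i < N \<Longrightarrow> \<beta> i < N"
  using g_V[OF zero_V] g_eq[OF zero_V] by (auto simp: V_def)

lemma \<beta>_inj: "i < N \<Longrightarrow> i' < N \<Longrightarrow> \<beta> i = \<beta> i' \<longleftrightarrow> i = i'"
  using g_inj[OF zero_V zero_V, of i i'] g_eq[OF zero_V] by auto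

lemma \<beta>_step:
  assumes "Suc i < N"
  shows "\<beta> (Suc i) = Suc (\<beta> i) mod N \<or> \<beta> i = Suc (\<beta> (Suc i)) mod N"
proof -
  have V: "(0, i) \<in> V" "(0, Suc i) \<in> V" using assms zero_V by simp_all
  have "cross_adj (0, i) (0, Suc i)" using assms by (simp add: cross_adj_def)
  then have "cross_adj (g (0, i)) (g (0, Suc i))" using g_cross_adj[OF V] by blast
  then show ?thesis by (simp add: cross_adj_def g_eq[OF V(1)] g_eq[OF V(2)])
qed

lemma \<alpha>_fibre:
  assumes "0 \<le> j" "j < M" "0 \<le> j'" "j' < M"
  shows "[\<alpha> j = \<alpha> j'] (mod Q) \<longleftrightarrow> [j = j'] (mod Q)"
proof -
  have V: "(j, 0) \<in> V" "(j', 0) \<in> V" using assms N_ge_3 by (simp_all add: V_iff)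
  show ?thesis
    using g_same_fibre[OF V] by (simp add: same_fibre_def g_eq[OF V(1)] g_eq[OF V(2)])
qed

lemma \<alpha>_layer:
  assumes i: "i < N" and j: "0 \<le> j" "j < M" "0 \<le> j'" "j' < M" and c: "[j' = j + l ^ i] (mod Q)"
  shows "[\<alpha> j' = \<alpha> j + l ^ \<beta> i] (mod Q) \<or> [\<alpha> j' = \<alpha> j - l ^ \<beta> i] (mod Q)"
proof -
  have V: "(j, i) \<in> V" "(j', i) \<in> V" using i j by (simp_all add: V_iff)
  have "layer_adj (j, i) (j', i)" using c by (simp add: layer_adj_def)
  then have "layer_adj (g (j, i)) (g (j', i))" using g_layer_adj[OF V] by blast
  then show ?thesis by (simp add: layer_adj_def g_eq[OF V(1)] g_eq[OF V(2)])
qed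

text \<open>Modulo fibres, layer 0 is a cycle of length \<open>Q\<close>. Each step along it is
  mapped to a step \<open>d\<close> or \<open>- d\<close>, and the image never turns back, so the
  first sign persists.\<close>

lemma \<alpha>_affine:
  obtains e where "e = 1 \<or> e = - 1"
    "\<And>j. 0 \<le> j \<Longrightarrow> j < M \<Longrightarrow> [\<alpha> j = \<alpha> 0 + e * l ^ \<beta> 0 * j] (mod Q)"
proof -
  define d where "d = l ^ \<beta> 0"
  define A where "A k = \<alpha> (int k mod M)" for k
  have mM: "0 \<le> x mod M" "x mod M < M" for x using M_pos by simp_all
  have step: "[A (Suc k) = A k + d] (mod Q) \<or> [A (Suc k) = A k - d] (mod Q)" for k
  proof -
    have "[int (Suc k) mod M = int k mod M + l ^ 0] (mod M)"
      by (simp add: cong_def mod_simps add.commute)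
    then show ?thesis
      unfolding A_def d_def using \<alpha>_layer[OF _ mM mM] cong_M_imp_cong_Q N_ge_3 by simp
  qed
  \<comment> \<open>Turning back would put two columns at distance 2 in one fibre, although
    \<open>Q\<close> does not divide 2.\<close>
  have two: "\<not> [A (Suc (Suc k)) = A k] (mod Q)" for k
  proof
    assume "[A (Suc (Suc k)) = A k] (mod Q)"
    then have "[int (Suc (Suc k)) mod M = int k mod M] (mod Q)"
      unfolding A_def using \<alpha>_fibre[OF mM mM] by blast
    moreover have "[int (Suc (Suc k)) mod M = int (Suc (Suc k))] (mod Q)" "[int k mod M = int k] (mod Q)"
      by (auto intro: cong_M_imp_cong_Q)
    ultimately have "[int (Suc (Suc k)) = int k] (mod Q)" using cong_sym cong_trans by blast
    then have "Q dvd 2 * 1" by (simp add: cong_iff_dvd_diff)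
    then show False using not_cong_Q_if_cong_1(2)[of 1] by simp
  qed
  obtain e where e: "e = 1 \<or> e = - 1" and e0: "[A (Suc 0) = A 0 + e * d] (mod Q)"
    using step[of 0] by (metis diff_conv_add_uminus mult_1 mult_minus_left)
  have inc: "[A (Suc k) = A k + e * d] (mod Q)" for k
  proof (induction k)
    case (Suc k)
    have "[A (Suc (Suc k)) = A (Suc k) + e * d] (mod Q) \<or> [A (Suc (Suc k)) = A (Suc k) - e * d] (mod Q)"
      using step[of "Suc k"] e by auto
    then show ?case
    proof
      assume "[A (Suc (Suc k)) = A (Suc k) - e * d] (mod Q)"
      also have "[A (Suc k) - e * d = A k + e * d - e * d] (mod Q)"
        by (intro cong_diff Suc.IH cong_refl)
      finally have "[A (Suc (Suc k)) = A k] (mod Q)" by simp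
      with two show ?thesis by blast
    qed
  qed (rule e0)
  have aff: "[A k = A 0 + e * d * int k] (mod Q)" for k
  proof (induction k)
    case (Suc k)
    have "[A (Suc k) = A k + e * d] (mod Q)" by (rule inc)
    also have "[A k + e * d = (A 0 + e * d * int k) + e * d] (mod Q)"
      by (intro cong_add Suc cong_refl)
    finally show ?case by (simp add: algebra_simps)
  qed simp
  have "[\<alpha> j = \<alpha> 0 + e * l ^ \<beta> 0 * j] (mod Q)" if "0 \<le> j" "j < M" for j
    using aff[of "nat j"] that by (simp add: A_def d_def)
  with e show thesis using that by blast
qed

text \<open>Going from column 0 to column \<open>l\<close> is one step in layer 1, so it changes
  \<open>\<alpha>\<close> by \<open>l ^ \<beta> 1\<close> up to sign. The affine form gives a change
  of \<open>l ^ \<beta> 0 * l\<close> up to sign. If layers were reversed, the second would be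
  \<open>l\<^sup>2\<close> times the first, making \<open>l\<^sup>2\<close> a sign modulo
  \<open>Q\<close>.\<close>

lemma \<beta>_1: "\<beta> 1 = Suc (\<beta> 0) mod N"
proof (rule ccontr)
  assume "\<beta> 1 \<noteq> Suc (\<beta> 0) mod N"
  then have b: "\<beta> 0 = Suc (\<beta> 1) mod N" using \<beta>_step[of 0] N_ge_3 by simp
  obtain e where e: "e = 1 \<or> e = - 1"
    and aff: "\<And>j. 0 \<le> j \<Longrightarrow> j < M \<Longrightarrow> [\<alpha> j = \<alpha> 0 + e * l ^ \<beta> 0 * j] (mod Q)"
    using \<alpha>_affine by blast
  define j where "j = l mod M"
  have j: "0 \<le> j" "j < M" using M_pos by (simp_all add: j_def)
  have jl: "[j = l] (mod Q)" unfolding j_def by (rule cong_M_imp_cong_Q) simp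
  define d where "d = l ^ \<beta> 1"
  have "[\<alpha> j = \<alpha> 0 + d] (mod Q) \<or> [\<alpha> j = \<alpha> 0 - d] (mod Q)"
    using \<alpha>_layer[of 1 0 j] j jl M_pos N_ge_3 by (simp add: d_def)
  then obtain e' where e': "e' = 1 \<or> e' = - 1" "[\<alpha> j = \<alpha> 0 + e' * d] (mod Q)"
    by (metis diff_conv_add_uminus mult_1 mult_minus_left)
  have "[e * l ^ \<beta> 0 * j = e * (d * l) * l] (mod Q)"
    using l_pow_mod_N[of "Suc (\<beta> 1)"] unfolding b d_def
    by (intro cong_mult cong_refl jl) (simp add: mult.commute)
  then have "[\<alpha> 0 + e * l ^ \<beta> 0 * j = \<alpha> 0 + e * (d * l) * l] (mod Q)"
    by (rule cong_add[OF cong_refl])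
  then have "[\<alpha> 0 + e' * d = \<alpha> 0 + e * (d * l) * l] (mod Q)"
    using aff[OF j] e'(2) cong_sym cong_trans by blast
  then have "Q dvd d * (e' - e * l\<^sup>2)"
    by (simp add: cong_iff_dvd_diff algebra_simps power2_eq_square)
  moreover have "coprime Q d"
    unfolding d_def using coprime_if_cong_1(1)[OF l_pow_cong_1] by (simp add: coprime_commute)
  ultimately have "Q dvd e' - e * l\<^sup>2" by (simp add: coprime_dvd_mult_right_iff)
  then have "Q dvd e * (e' - e * l\<^sup>2)" by simp
  then have "[e * e' = l\<^sup>2] (mod Q)"
    using e by (auto simp: cong_iff_dvd_diff)
  then have "[l\<^sup>2 = e * e'] (mod Q)" by (rule cong_sym)
  moreover have "e * e' = 1 \<or> e * e' = - 1" using e e'(1) by auto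
  ultimately show False using l_squared by auto
qed

text \<open>The direction fixed by \<open>\<beta>_1\<close> cannot reverse later, since a reversal
  would give two layers the same image.\<close>

lemma \<beta>_shift: "i < N \<Longrightarrow> \<beta> i = (\<beta> 0 + i) mod N"
proof (induction i)
  case 0
  then show ?case using \<beta>_less by simp
next
  case (Suc i)
  have inc: "Suc k < N \<Longrightarrow> \<beta> (Suc k) = Suc (\<beta> k) mod N" for k
  proof (induction k)
    case 0
    then show ?case using \<beta>_1 by simp
  next
    case (Suc k)
    show ?case
    proof (rule ccontr)
      assume "\<not> ?case"
      then have "\<beta> (Suc k) = Suc (\<beta> (Suc (Suc k))) mod N" using \<beta>_step[OF Suc.prems] by blast
      moreover have "\<beta> (Suc k) = Suc (\<beta> k) mod N" using Suc by simp
      ultimately have "\<beta> k = \<beta> (Suc (Suc k))"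
        using Suc_mod_eq_iff[OF \<beta>_less \<beta>_less, of k "Suc (Suc k)"] Suc.prems by simp
      then show False using \<beta>_inj[of k "Suc (Suc k)"] Suc.prems by simp
    qed
  qed
  from inc[OF Suc.prems] Suc show ?case by (simp add: mod_simps)
qed

text \<open>The last clause is exact rather than modulo \<open>Q\<close>: an automorphism that keeps
  \<open>(0, 0)\<close> in column 0 keeps all of that column in place.\<close>

lemma automorphism_affine:
  obtains e where "e = 1 \<or> e = - 1"
    "\<And>v. v \<in> V \<Longrightarrow> [fst (g v) = fst (g (0, 0)) + e * l ^ snd (g (0, 0)) * fst v] (mod Q)"
    "\<And>v. v \<in> V \<Longrightarrow> snd (g v) = (snd (g (0, 0)) + snd v) mod N"
    "\<And>j i. (j, i) \<in> V \<Longrightarrow> fst (g (j, i)) = fst (g (j, 0))"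
proof -
  obtain e where e: "e = 1 \<or> e = - 1"
    and aff: "\<And>j. 0 \<le> j \<Longrightarrow> j < M \<Longrightarrow> [\<alpha> j = \<alpha> 0 + e * l ^ \<beta> 0 * j] (mod Q)"
    using \<alpha>_affine by blast
  have z: "g (0, 0) = (\<alpha> 0, \<beta> 0)" using g_eq zero_V N_ge_3 by simp
  show thesis
  proof (rule that[OF e])
    fix v assume "v \<in> V"
    moreover obtain j i where v: "v = (j, i)" by fastforce
    ultimately have ji: "(j, i) \<in> V" by simp
    then show "[fst (g v) = fst (g (0, 0)) + e * l ^ snd (g (0, 0)) * fst v] (mod Q)"
      using aff[of j] by (simp add: v z g_eq V_iff)
    show "snd (g v) = (snd (g (0, 0)) + snd v) mod N"
      using \<beta>_shift[of i] ji by (simp add: v z g_eq V_iff)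
  next
    fix j i assume "(j, i) \<in> V"
    then show "fst (g (j, i)) = fst (g (j, 0))" by (simp add: fst_g \<alpha>_def)
  qed
qed

end

section \<open>Regular groups are not metacyclic\<close>

text \<open>The connection set multiplies from the left, so right translations commute with it; the
  converse translates back by \<open>inv a\<close>.\<close>

lemma (in group) Cay_edge_translate:
  assumes S: "S \<subseteq> carrier G" and gha: "g \<in> carrier G" "h \<in> carrier G" "a \<in> carrier G"
  shows "{g \<otimes> a, h \<otimes> a} \<in> edges (Cay G S) \<longleftrightarrow> {g, h} \<in> edges (Cay G S)"
proof -
  have tr: "{g \<otimes> a, h \<otimes> a} \<in> edges (Cay G S)"
    if e: "{g, h} \<in> edges (Cay G S)" and gha: "g \<in> carrier G" "h \<in> carrier G" "a \<in> carrier G" for g h a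
  proof -
    obtain x s where x: "x \<in> carrier G" "s \<in> S" and eq: "{g, h} = {x, s \<otimes> x}"
      using e by (auto simp: Cay_def)
    have "s \<in> carrier G" using x S by blast
    then have "(\<lambda>y. y \<otimes> a) ` {x, s \<otimes> x} = {x \<otimes> a, s \<otimes> (x \<otimes> a)}"
      using x gha by (simp add: m_assoc)
    then have "{g \<otimes> a, h \<otimes> a} = {x \<otimes> a, s \<otimes> (x \<otimes> a)}" using eq by (metis image_empty image_insert)
    moreover have "x \<otimes> a \<in> carrier G" using x gha by simp
    ultimately show ?thesis unfolding Cay_def using x(2) by (simp only: ugraph.simps mem_Collect_eq) blast
  qed
  show ?thesis
  proof
    assume "{g \<otimes> a, h \<otimes> a} \<in> edges (Cay G S)"
    from tr[OF this, of "inv a"] show "{g, h} \<in> edges (Cay G S)" using gha by (simp add: m_assoc)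
  qed (rule tr[OF _ gha])
qed

lemma (in group) odd_order_square_root:
  assumes "odd (order G)" "x \<in> carrier G"
  obtains y where "y \<in> carrier G" "x = y \<otimes> y"
proof -
  obtain k where k: "order G = 2 * k + 1" using assms(1) by (rule oddE)
  have "x [^] (k + 1) \<otimes> x [^] (k + 1) = x [^] ((k + 1) + (k + 1))"
    by (rule nat_pow_mult[OF assms(2)])
  also have "(k + 1) + (k + 1) = order G + 1" by (simp add: k)
  also have "x [^] (order G + 1) = x" using assms(2) pow_order_eq_1 by simp
  finally have "x = x [^] (k + 1) \<otimes> x [^] (k + 1)" ..
  then show thesis using that[of "x [^] (k + 1)"] assms(2) by blast
qed

context petersen
begin

text \<open>Right translations of \<open>G\<close>, carried to \<open>V\<close> by \<open>f\<close>,
  form a regular group of automorphisms. Evaluating them at \<open>(0, 0)\<close> supplies the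
  column and layer maps of \<open>crossed_hom\<close>.\<close>

lemma no_metacyclic_Cayley:
  fixes G (structure)
  assumes G: "group G" and S: "connection_set G S" and f: "graph_isomorphism \<Gamma> (Cay G S) f"
  shows "\<not> metacyclic_group G"
proof -
  interpret group G by (rule G)
  have SG: "S \<subseteq> carrier G" using S by (auto simp: connection_set_def)
  have f_bij: "bij_betw f V (carrier G)"
    using f unfolding graph_isomorphism_def verts_MP by (simp add: Cay_def)
  have f_adj: "{f u, f v} \<in> edges (Cay G S) \<longleftrightarrow> adj u v" if "u \<in> V" "v \<in> V" for u v
    using f that edge_iff_adj unfolding graph_isomorphism_def verts_MP by metis
  have fG: "f v \<in> carrier G" if "v \<in> V" for v using bij_betwE[OF f_bij] that by blast
  have order: "order G = p ^ (m + n)"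
    using bij_betw_same_card[OF f_bij] card_V by (simp add: order_def)
  define fi where "fi = inv_into V f"
  have fi: "fi g \<in> V" "f (fi g) = g" if "g \<in> carrier G" for g
    using f_bij that by (auto simp: fi_def bij_betw_def inv_into_into f_inv_into_f)
  have fi_f: "fi (f v) = v" if "v \<in> V" for v
    using f_bij that by (simp add: fi_def bij_betw_def inv_into_f_f)
  \<comment> \<open>Translating by the inverse makes \<open>\<phi>\<close> a left action, so that
    \<open>\<phi>\<close> respects products in their given order.\<close>
  define \<phi> where "\<phi> x v = fi (f v \<otimes> inv x)" for x v
  have \<phi>_V: "\<phi> x v \<in> V" if "x \<in> carrier G" "v \<in> V" for x v
    using that fi fG by (simp add: \<phi>_def)
  have \<phi>_mult: "\<phi> (x \<otimes> y) v = \<phi> x (\<phi> y v)" if "x \<in> carrier G" "y \<in> carrier G" "v \<in> V" for x y v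
    using that fi fG by (simp add: \<phi>_def inv_mult_group m_assoc)
  have \<phi>_one: "\<phi> \<one> v = v" if "v \<in> V" for v
    using that fG fi_f by (simp add: \<phi>_def)
  have \<phi>_aut: "petersen_automorphism p m n lam (\<phi> x)" if x: "x \<in> carrier G" for x
  proof (unfold_locales, unfold graph_isomorphism_def verts_MP, intro conjI ballI)
    show "bij_betw (\<phi> x) V V"
    proof (rule bij_betwI[of _ _ _ "\<phi> (inv x)"])
      show "\<phi> (inv x) (\<phi> x v) = v" "\<phi> x (\<phi> (inv x) v) = v" if "v \<in> V" for v
        using \<phi>_mult[of "inv x" x v] \<phi>_mult[of x "inv x" v] x that \<phi>_one by simp_all
    qed (use \<phi>_V x in auto)
    fix u v assume uv: "u \<in> V" "v \<in> V"
    have "adj (\<phi> x u) (\<phi> x v) \<longleftrightarrow> {f u \<otimes> inv x, f v \<otimes> inv x} \<in> edges (Cay G S)"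
      using f_adj[OF \<phi>_V \<phi>_V, OF x uv(1) x uv(2)] fi fG x uv by (simp add: \<phi>_def)
    also have "\<dots> \<longleftrightarrow> adj u v"
      using Cay_edge_translate[OF SG fG fG, OF uv] f_adj[OF uv] x by simp
    finally show "({u, v} \<in> edges \<Gamma>) = ({\<phi> x u, \<phi> x v} \<in> edges \<Gamma>)"
      using edge_iff_adj[OF uv] edge_iff_adj[OF \<phi>_V \<phi>_V, OF x uv(1) x uv(2)] by blast
  qed
  have z: "(0, 0) \<in> V" using M_pos N_ge_3 by (simp add: V_def)
  define c where "c x = fst (\<phi> x (0, 0))" for x
  define b where "b x = snd (\<phi> x (0, 0))" for x
  have \<phi>_sgn: "\<exists>e. (e = 1 \<or> e = - 1) \<and> (\<forall>v\<in>V. [fst (\<phi> x v) = c x + e * l ^ b x * fst v] (mod Q))"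
    and \<phi>_snd: "v \<in> V \<Longrightarrow> snd (\<phi> x v) = (b x + snd v) mod N"
    and \<phi>_col: "(j, i) \<in> V \<Longrightarrow> fst (\<phi> x (j, i)) = fst (\<phi> x (j, 0))"
    if x: "x \<in> carrier G" for x v j i
    using petersen_automorphism.automorphism_affine[OF \<phi>_aut[OF x]] unfolding c_def b_def by metis+
  \<comment> \<open>The group has odd order, so \<open>x\<close> is a square
    \<open>y \<otimes> y\<close> and the sign \<open>e\<close> of \<open>y\<close> enters twice and
    cancels.\<close>
  have \<phi>_fst: "[fst (\<phi> x v) = c x + l ^ b x * fst v] (mod Q)" if x: "x \<in> carrier G" and v: "v \<in> V" for x v
  proof -
    have "odd (order G)" using order odd_p by simp
    then obtain y where y: "y \<in> carrier G" "x = y \<otimes> y" using odd_order_square_root x by blast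
    obtain e where e: "e = 1 \<or> e = - 1" and aff: "\<And>v. v \<in> V \<Longrightarrow> [fst (\<phi> y v) = c y + e * l ^ b y * fst v] (mod Q)"
      using \<phi>_sgn[OF y(1)] by blast
    have ee: "e * e = 1" using e by auto
    have main: "[fst (\<phi> x v) = (c y + e * l ^ b y * c y) + l ^ b x * fst v] (mod Q)" if v: "v \<in> V" for v
    proof -
      have "[fst (\<phi> x v) = c y + e * l ^ b y * fst (\<phi> y v)] (mod Q)"
        unfolding y(2) \<phi>_mult[OF y(1) y(1) v] by (rule aff[OF \<phi>_V[OF y(1) v]])
      also have "[c y + e * l ^ b y * fst (\<phi> y v) = c y + e * l ^ b y * (c y + e * l ^ b y * fst v)] (mod Q)"
        by (intro cong_add cong_mult cong_refl aff[OF v])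
      also have "c y + e * l ^ b y * (c y + e * l ^ b y * fst v)
          = (c y + e * l ^ b y * c y) + (e * e) * l ^ (b y + b y) * fst v"
        by (simp add: algebra_simps power_add)
      also have "\<dots> = (c y + e * l ^ b y * c y) + l ^ (b y + b y) * fst v" by (simp add: ee)
      also have "[(c y + e * l ^ b y * c y) + l ^ (b y + b y) * fst v
          = (c y + e * l ^ b y * c y) + l ^ ((b y + b y) mod N) * fst v] (mod Q)"
        by (intro cong_add cong_mult cong_refl cong_sym[OF l_pow_mod_N])
      also have "(b y + b y) mod N = b x"
        using \<phi>_mult[OF y(1) y(1) z] \<phi>_snd[OF y(1) \<phi>_V[OF y(1) z]] y(2) by (simp add: b_def)
      finally show ?thesis .
    qed
    have "[c x = c y + e * l ^ b y * c y] (mod Q)" using main[OF z] by (simp add: c_def)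
    from main[OF v] cong_add[OF cong_sym[OF this] cong_refl] show ?thesis by (rule cong_trans)
  qed
  interpret crossed_hom G c b Q l N
  proof unfold_locales
    fix x y assume xy: "x \<in> carrier G" "y \<in> carrier G"
    show "[c (x \<otimes> y) = c x + l ^ b x * c y] (mod Q)"
      using \<phi>_fst[OF xy(1) \<phi>_V[OF xy(2) z]] \<phi>_mult[OF xy z] by (simp add: c_def)
    show "b (x \<otimes> y) = (b x + b y) mod N"
      using \<phi>_snd[OF xy(1) \<phi>_V[OF xy(2) z]] \<phi>_mult[OF xy z] by (simp add: b_def)
  next
    fix x assume "x \<in> carrier G"
    then show "b x < N" using \<phi>_V[OF _ z, of x] by (auto simp: b_def V_def)
  qed
  have orb_inj: "x = y" if "x \<in> carrier G" "y \<in> carrier G" "\<phi> x (0, 0) = \<phi> y (0, 0)" for x y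
  proof -
    have "f (0, 0) \<otimes> inv x = f (0, 0) \<otimes> inv y"
      using arg_cong[OF that(3), of f] that(1,2) fi fG[OF z] by (simp add: \<phi>_def)
    then show ?thesis using that(1,2) fG[OF z] by (metis inv_closed inv_inv l_cancel)
  qed
  have orb_surj: "\<exists>x\<in>carrier G. \<phi> x (0, 0) = v" if v: "v \<in> V" for v
  proof
    have "f (0, 0) \<otimes> inv (inv (f v) \<otimes> f (0, 0)) = f v"
      using fG[OF z] fG[OF v] by (simp add: inv_mult_group m_assoc[symmetric])
    then show "\<phi> (inv (f v) \<otimes> f (0, 0)) (0, 0) = v" using fi_f[OF v] by (simp add: \<phi>_def)
    show "inv (f v) \<otimes> f (0, 0) \<in> carrier G" using fG[OF z] fG[OF v] by simp
  qed
  have "Q \<le> M" using Q_dvd_M M_pos by (rule zdvd_imp_le)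
  then have "(0, 1) \<in> V" "(1, 0) \<in> V" using N_ge_3 Q_gt_2 by (simp_all add: V_def)
  then obtain s t where s: "s \<in> carrier G" "\<phi> s (0, 0) = (0, 1)" and t: "t \<in> carrier G" "\<phi> t (0, 0) = (1, 0)"
    using orb_surj by metis
  \<comment> \<open>As \<open>s\<close> keeps \<open>(0, 0)\<close> in column 0, it maps that column
    to itself exactly by \<open>\<phi>_col\<close>. So \<open>s [^] N\<close> fixes
    \<open>(0, 0)\<close>, and regularity makes it trivial.\<close>
  have s_pow: "\<phi> (s [^] k) (0, 0) = (0, k mod N)" for k :: nat
  proof (induction k)
    case (Suc k)
    have kV: "(0, k mod N) \<in> V" using M_pos N_ge_3 by (simp add: V_def)
    have "\<phi> (s [^] Suc k) (0, 0) = \<phi> s (0, k mod N)"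
      using nat_pow_Suc2[OF s(1), of k] \<phi>_mult[of s "s [^] k" "(0, 0)"] s(1) z Suc by simp
    moreover have "fst (\<phi> s (0, k mod N)) = 0" using \<phi>_col[OF s(1) kV] s(2) by simp
    moreover have "snd (\<phi> s (0, k mod N)) = Suc k mod N"
      using \<phi>_snd[OF s(1) kV] s(2) by (simp add: b_def mod_simps)
    ultimately show ?case by (simp add: prod_eq_iff)
  qed (simp add: \<phi>_one z)
  have "s [^] N = \<one>"
    by (rule orb_inj) (use s(1) s_pow[of N] \<phi>_one z in simp_all)
  \<comment> \<open>The orbit map of \<open>(0, 0)\<close> identifies \<open>K\<close> with the
    fibre of \<open>(0, 0)\<close>, the vertices of layer 0 whose column is a multiple of
    \<open>Q\<close>.\<close>
  moreover have "card K = p"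
  proof -
    define W where "W = (\<lambda>k. (Q * int k, 0 :: nat)) ` {..<p}"
    have "(\<lambda>x. \<phi> x (0, 0)) ` K = W"
    proof
      show "(\<lambda>x. \<phi> x (0, 0)) ` K \<subseteq> W"
      proof
        fix w assume "w \<in> (\<lambda>x. \<phi> x (0, 0)) ` K"
        then obtain x where w: "w = \<phi> x (0, 0)" and "x \<in> K" by blast
        then have x: "x \<in> carrier G" "Q dvd c x" "b x = 0" by (auto simp: K_def cong_0_iff)
        have V: "\<phi> x (0, 0) \<in> V" by (rule \<phi>_V[OF x(1) z])
        obtain k where k: "c x = Q * k" using x(2) ..
        have "0 \<le> Q * k" "Q * k < Q * int p"
          using V k by (auto simp: V_def M_eq c_def mult.commute)
        then have "0 \<le> k" "k < int p" using Q_pos by (auto simp: zero_le_mult_iff)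
        moreover have "\<phi> x (0, 0) = (Q * k, 0)" using k x(3) by (simp add: c_def b_def prod_eq_iff)
        ultimately show "w \<in> W"
          unfolding W_def w by (intro image_eqI[of _ _ "nat k"]) auto
      qed
      show "W \<subseteq> (\<lambda>x. \<phi> x (0, 0)) ` K"
      proof
        fix w assume "w \<in> W"
        then obtain k where k: "k < p" "w = (Q * int k, 0)" by (auto simp: W_def)
        have "Q * int k < M" using k Q_pos by (simp add: M_eq mult.commute)
        then have "w \<in> V" using k Q_pos N_ge_3 by (simp add: V_def)
        then obtain x where x: "x \<in> carrier G" "\<phi> x (0, 0) = w" using orb_surj by blast
        then have "x \<in> K" using k by (simp add: K_def c_def b_def cong_0_iff)
        with x show "w \<in> (\<lambda>x. \<phi> x (0, 0)) ` K" by blast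
      qed
    qed
    moreover have "inj_on (\<lambda>x. \<phi> x (0, 0)) K" using orb_inj K_carrier by (intro inj_onI) blast
    moreover have "card W = p"
      unfolding W_def using Q_pos by (subst card_image) (auto simp: inj_on_def)
    ultimately show ?thesis by (metis card_image)
  qed
  moreover have "m \<ge> 3" using m_ge n_ge by simp
  ultimately show ?thesis
    using s(1,2) t
    by (intro not_metacyclic[OF prime_p _ n_ge Q_def N_def l_cong_1 l_pow_N_not_cong_M order,
          where s = s and t = t])
      (auto simp: c_def b_def N_def)
qed

end

theorem theorem6p1:
  fixes p m n lam :: nat
  assumes "Factorial_Ring.prime p" and "odd p"
    and "m \<ge> n + 2" and "n + 2 \<ge> 3"
    and "coprime lam (p ^ m)" and "ord (p ^ m) lam = p ^ (n + 1)"
  shows "weak_metacirculant (MP (p ^ m) (p ^ n) (p ^ (m - 1)) lam) \<and>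
         Cayley_graph (MP (p ^ m) (p ^ n) (p ^ (m - 1)) lam) \<and>
         \<not> weak_metacirculant_Cayley_graph (MP (p ^ m) (p ^ n) (p ^ (m - 1)) lam)"
proof -
  interpret petersen p m n lam
    by unfold_locales (use assms in simp_all)
  show ?thesis
    using weak_metacirculant_MP Cayley_graph_MP no_metacyclic_Cayley
    unfolding weak_metacirculant_Cayley_graph_def isomorphic_graphs_def metacyclic_group_def by blast
qed

end
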